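(* Let $k$ be a field of characteristic $0$ and $\mathcal A$ a small dg-category over $k$. Let ${}_1E$ be the spectral sequence of the filtration $F_1^s\,\mathcal T(EC(\mathcal A))^n=\bigoplus_{p+q+r=n,\ p\ge s}EC(\mathcal A)^{p,q,r}$, which has ${}_1E_2^{p,q}\simeq H^p(\Delta_-^qHH^*_{dg}(\mathcal A))$ and converges to $HC^{p+q}_{dg}(\mathcal A)$. When ${}_1E$ degenerates at the $E_2$ page, there is a surjection $$HC^n_{dg}(\mathcal A)\to\ker\big(HH^n_{dg}(\mathcal A)\to HH^{n-1}_{dg}(\mathcal A)\big)$$ for all $n\ge1$, where $HH^n_{dg}(\mathcal A)\to HH^{n-1}_{dg}(\mathcal A)$ is the map induced by $B$.
   Context: **Dg-categories.** $\mathcal A$ is a small category enriched in complexes of $k$-vector spaces; each $\mathcal A(X,Y)$ is non-negatively graded with differential $\phi$ lowering degree by one, composition satisfies the graded Leibniz rule, and identities are degree-$0$ cycles. The dual $\mathcal A$-bimodule is $\mathcal D(X_1,X_2)=\mathcal A(X_2,X_1)^*$ ($k$-linear dual). The Hochschild bicomplex with coefficients in $\mathcal D$ is $$EH(\mathcal A)^{n,m}=\prod_{(X_0,\dots,X_n)}\mathrm{Hom}_k\big(\mathcal A(X_{n-1},X_n)\otimes\dots\otimes\mathcal A(X_0,X_1),\mathcal D(X_0,X_n)\big)^m,$$ the product being over all sequences of $n+1$ objects. By adjunction (reindexing $Y_0=X_0,\ Y_i=X_{n+1-i}$ for $1\le i\le n$), this is $C^n(\mathcal A)^m=\prod_{(Y_0,\dots,Y_n)}\mathrm{Hom}_k\big((\mathcal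 A(Y_1,Y_0)\otimes\mathcal A(Y_2,Y_1)\otimes\dots\otimes\mathcal A(Y_0,Y_n))^m,k\big)$, whose elements are families $f$ of functionals evaluated on cyclically composable $a_0\otimes\dots\otimes a_n$, $a_i\in\mathcal A(Y_{i+1},Y_i)$, $Y_{n+1}=Y_0$; the superscript $m$ is the total-degree-$m$ part. **Operators** (homogeneous $a_i$, $\gamma_n=|a_n|(|a_0|+\dots+|a_{n-1}|)$): - $\delta:C^n(\mathcal A)^m\to C^n(\mathcal A)^{m+1}$, $\delta f(a_0\otimes\dots\otimes a_n)=(-1)^m\sum_i(-1)^{|a_0|+\dots+|a_{i-1}|}f(a_0\otimes\dots\otimes\phi(a_i)\otimes\dots\otimes a_n)$. - $b:C^{n-1}(\mathcal A)^m\to C^n(\mathcal A)^m$, $b(f)(a_0\otimes\dots\otimes a_n)=\sum_{i=0}^{n-1}(-1)^if(a_0\otimes\dots\otimes a_ia_{i+1}\otimes\dots\otimes a_n)+(-1)^{n+\gamma_n}f(a_na_0\otimes a_1\otimes\dots\otimes a_{n-1})$. - $\tau(f)(a_0\otimes\dots\otimes a_n)=(-1)^{n+\gamma_n}f(a_n\otimes a_0\otimes\dots\otimes a_{n-1})$ and $N=\sum_{i=0}^n\tau^i$ on $C^n(\mathcal A)^m$. - $s:C^{n+1}(\mathcal A)^m\to C^n(\mathcal A)^m$, $s(f)(a_0\otimes\dots\otimes a_n)=(-1)^nf(a_0\otimes\dots\otimes a_n\otimes 1_{Y_0})$. - $B=Ns(\mathbf 1-\tau):C^{n+1}(\mathcal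 A)^m\to C^n(\mathcal A)^m$ ($B=0$ on $C^0(\mathcal A)^m$). **Hochschild and cyclic cohomology.** $HH^n_{dg}(\mathcal A):=HH^n_{dg}(\mathcal A,\mathcal D)$ is the $n$-th cohomology of $\bigoplus_{p+q=n}C^p(\mathcal A)^q$ with differential $b+(-1)^p\delta$; $B$ anticommutes with this differential and induces maps $HH^n_{dg}(\mathcal A)\to HH^{n-1}_{dg}(\mathcal A)$. $EC(\mathcal A)^{p,q,r}=C^{q-p}(\mathcal A)^r$ for $0\le p\le q$, $r\ge0$ (zero otherwise); $\mathcal T(EC(\mathcal A))^n=\bigoplus_{p+q+r=n}EC(\mathcal A)^{p,q,r}$ with differential $b+B+(-1)^{q-p}\delta$ ($b$ raises $q$, $B$ raises $p$, $\delta$ raises $r$); $HC^n_{dg}(\mathcal A)=H^n(\mathcal T(EC(\mathcal A)))$. **Truncation.** $\Delta_-^qHH^*_{dg}(\mathcal A)$ is the cochain complex $HH^q_{dg}(\mathcal A)\to HH^{q-1}_{dg}(\mathcal A)\to\dots\to HH^0_{dg}(\mathcal A)\to0$ with $HH^{q-n}_{dg}(\mathcal A)$ in degree $n$ for $0\le n\le q$, and differential induced by $B$. **Degeneration.** The spectral sequence degenerates at $E_2$ if all differentials $d_r$ with $r\ge2$ vanish. *)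

theory Defs
  imports
    Complex_Main
    "HOL-Library.Function_Algebras"
    "HOL-Library.Set_Algebras"
    "HOL-Algebra.AbelCoset"
    "HOL-Algebra.Module"
begin

section \<open>Quotients of vector spaces\<close>

text \<open>
  Subspaces live in an ambient abelian group carrying a scalar multiplication \<open>scl\<close>.
  The quotient \<open>Z / W\<close> consists of the cosets \<open>z + W\<close> with \<open>z \<in> Z\<close>; sums of cosets are
  sums of sets. A scalar multiple is \<open>c \<cdot> U + W\<close> and not just \<open>c \<cdot> U\<close>, which would
  not be a coset for \<open>c = 0\<close>. Only the additive and scalar structure of the record is used.
\<close>

definition quotient_space ::
    "('k \<Rightarrow> 'x \<Rightarrow> 'x) \<Rightarrow> 'x set \<Rightarrow> 'x set \<Rightarrow> ('k, 'x::ab_group_add set) module" where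
  "quotient_space scl Z W =
     \<lparr>carrier = (\<lambda>z. z +o W) ` Z, mult = undefined, one = undefined, zero = W,
      add = (+), smult = (\<lambda>c U. scl c ` U + W)\<rparr>"

text \<open>
  If \<open>f\<close> is additive and maps \<open>W\<close> into \<open>W'\<close>, then \<open>f ` (z + W) + W' = f z + W'\<close>.
\<close>

definition induced_map :: "('x \<Rightarrow> 'y) \<Rightarrow> 'y set \<Rightarrow> 'x set \<Rightarrow> 'y::ab_group_add set" where
  "induced_map f W' U = f ` U + W'"

definition linear_maps ::
    "('k, 'a) module \<Rightarrow> ('k, 'b) module \<Rightarrow> ('a \<Rightarrow> 'b) set" where
  "linear_maps V W =
     {F \<in> hom (add_monoid V) (add_monoid W).
        \<forall>c. \<forall>x \<in> carrier V. F (c \<odot>\<^bsub>V\<^esub> x) = c \<odot>\<^bsub>W\<^esub> F x}"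


section \<open>Cohomology and the spectral sequence of a filtered complex\<close>

text \<open>
  A cochain complex is a family \<open>T n\<close> of subspaces of one ambient space with a differential
  \<open>d\<close> mapping \<open>T n\<close> to \<open>T (n + 1)\<close>; a decreasing filtration is a family \<open>F s n \<subseteq> T n\<close>.
\<close>

definition cohomology ::
    "('k \<Rightarrow> 'x \<Rightarrow> 'x) \<Rightarrow> (int \<Rightarrow> 'x set) \<Rightarrow> ('x \<Rightarrow> 'x) \<Rightarrow> int \<Rightarrow>
     ('k, 'x::ab_group_add set) module" where
  "cohomology scl T d n = quotient_space scl {x \<in> T n. d x = 0} (d ` T (n - 1))"

definition ss_Z :: "(int \<Rightarrow> int \<Rightarrow> 'x set) \<Rightarrow> ('x \<Rightarrow> 'x) \<Rightarrow> int \<Rightarrow> int \<Rightarrow> int \<Rightarrow> 'x set" where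
  "ss_Z F d r s t = {x \<in> F s (s + t). d x \<in> F (s + r) (s + t + 1)}"

definition ss_B ::
    "(int \<Rightarrow> int \<Rightarrow> 'x set) \<Rightarrow> ('x \<Rightarrow> 'x) \<Rightarrow> int \<Rightarrow> int \<Rightarrow> int \<Rightarrow> 'x::ab_group_add set" where
  "ss_B F d r s t = ss_Z F d (r - 1) (s + 1) (t - 1) + d ` ss_Z F d (r - 1) (s - r + 1) (t + r - 2)"

text \<open>The page \<open>E\<^sub>r\<close>, for \<open>r \<ge> 1\<close>, in filtration degree \<open>s\<close> and total degree \<open>s + t\<close>.\<close>

definition ss_E ::
    "('k \<Rightarrow> 'x \<Rightarrow> 'x) \<Rightarrow> (int \<Rightarrow> int \<Rightarrow> 'x set) \<Rightarrow> ('x \<Rightarrow> 'x) \<Rightarrow> int \<Rightarrow> int \<Rightarrow> int \<Rightarrow>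
     ('k, 'x::ab_group_add set) module" where
  "ss_E scl F d r s t = quotient_space scl (ss_Z F d r s t) (ss_B F d r s t)"

text \<open>The differential \<open>d\<^sub>r\<close> from \<open>E\<^sub>r\<close> at \<open>(s, t)\<close> to \<open>E\<^sub>r\<close> at \<open>(s + r, t - r + 1)\<close>.\<close>

definition ss_d ::
    "(int \<Rightarrow> int \<Rightarrow> 'x set) \<Rightarrow> ('x \<Rightarrow> 'x) \<Rightarrow> int \<Rightarrow> int \<Rightarrow> int \<Rightarrow> 'x set \<Rightarrow> 'x::ab_group_add set" where
  "ss_d F d r s t = induced_map d (ss_B F d r (s + r) (t - r + 1))"

definition degenerates_at ::
    "int \<Rightarrow> ('k \<Rightarrow> 'x \<Rightarrow> 'x) \<Rightarrow> (int \<Rightarrow> int \<Rightarrow> 'x set) \<Rightarrow> ('x \<Rightarrow> 'x::ab_group_add) \<Rightarrow> bool" where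
  "degenerates_at r0 scl F d \<longleftrightarrow>
     (\<forall>r \<ge> r0. \<forall>s t. \<forall>U \<in> carrier (ss_E scl F d r s t).
        ss_d F d r s t U = \<zero>\<^bsub>ss_E scl F d r (s + r) (t - r + 1)\<^esub>)"


section \<open>Small dg-categories\<close>

text \<open>
  \<open>Mor A X Y i\<close> is the degree-\<open>i\<close> part of the complex of morphisms from \<open>X\<close> to \<open>Y\<close>.
  All these parts are subspaces of one vector space, which is no restriction up to isomorphism,
  since any family of vector spaces embeds into its direct sum. They need not be disjoint or
  independent, so the operations take objects and degrees as arguments:
  \<open>Cmp A X Y Z i j g f\<close> is the composite of \<open>g\<close> in \<open>Mor A Y Z i\<close> and \<open>f\<close> in
  \<open>Mor A X Y j\<close>, and \<open>Dif A X Y i\<close> is the differential on \<open>Mor A X Y i\<close>. The latter is zero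
  for \<open>i = 0\<close>, which makes the truncated \<open>i - 1\<close> harmless.
\<close>

record ('k, 'o, 'v) dg_data =
  Scl :: "'k \<Rightarrow> 'v \<Rightarrow> 'v"
  Ob :: "'o set"
  Mor :: "'o \<Rightarrow> 'o \<Rightarrow> nat \<Rightarrow> 'v set"
  Dif :: "'o \<Rightarrow> 'o \<Rightarrow> nat \<Rightarrow> 'v \<Rightarrow> 'v"
  Cmp :: "'o \<Rightarrow> 'o \<Rightarrow> 'o \<Rightarrow> nat \<Rightarrow> nat \<Rightarrow> 'v \<Rightarrow> 'v \<Rightarrow> 'v"
  Idn :: "'o \<Rightarrow> 'v"

locale dg_category =
  fixes A :: "('k::field, 'o, 'v::ab_group_add) dg_data"
  assumes ambient: "vector_space (Scl A)"
    and Mor_subspace: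
      "\<lbrakk>X \<in> Ob A; Y \<in> Ob A\<rbrakk> \<Longrightarrow> Modules.module.subspace (Scl A) (Mor A X Y i)"
    and Dif_closed:
      "\<lbrakk>X \<in> Ob A; Y \<in> Ob A; f \<in> Mor A X Y i\<rbrakk> \<Longrightarrow> Dif A X Y i f \<in> Mor A X Y (i - 1)"
    and Dif_add:
      "\<lbrakk>X \<in> Ob A; Y \<in> Ob A; f \<in> Mor A X Y i; g \<in> Mor A X Y i\<rbrakk> \<Longrightarrow>
       Dif A X Y i (f + g) = Dif A X Y i f + Dif A X Y i g"
    and Dif_scale:
      "\<lbrakk>X \<in> Ob A; Y \<in> Ob A; f \<in> Mor A X Y i\<rbrakk> \<Longrightarrow>
       Dif A X Y i (Scl A c f) = Scl A c (Dif A X Y i f)"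
    and Dif_0:
      "\<lbrakk>X \<in> Ob A; Y \<in> Ob A; f \<in> Mor A X Y 0\<rbrakk> \<Longrightarrow> Dif A X Y 0 f = 0"
    and Dif_Dif:
      "\<lbrakk>X \<in> Ob A; Y \<in> Ob A; f \<in> Mor A X Y i\<rbrakk> \<Longrightarrow>
       Dif A X Y (i - 1) (Dif A X Y i f) = 0"
    and Cmp_closed:
      "\<lbrakk>X \<in> Ob A; Y \<in> Ob A; Z \<in> Ob A; g \<in> Mor A Y Z i; f \<in> Mor A X Y j\<rbrakk> \<Longrightarrow>
       Cmp A X Y Z i j g f \<in> Mor A X Z (i + j)"
    and Cmp_add_left:
      "\<lbrakk>X \<in> Ob A; Y \<in> Ob A; Z \<in> Ob A; g \<in> Mor A Y Z i; g' \<in> Mor A Y Z i; f \<in> Mor A X Y j\<rbrakk> \<Longrightarrow>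
       Cmp A X Y Z i j (g + g') f = Cmp A X Y Z i j g f + Cmp A X Y Z i j g' f"
    and Cmp_add_right:
      "\<lbrakk>X \<in> Ob A; Y \<in> Ob A; Z \<in> Ob A; g \<in> Mor A Y Z i; f \<in> Mor A X Y j; f' \<in> Mor A X Y j\<rbrakk> \<Longrightarrow>
       Cmp A X Y Z i j g (f + f') = Cmp A X Y Z i j g f + Cmp A X Y Z i j g f'"
    and Cmp_scale_left:
      "\<lbrakk>X \<in> Ob A; Y \<in> Ob A; Z \<in> Ob A; g \<in> Mor A Y Z i; f \<in> Mor A X Y j\<rbrakk> \<Longrightarrow>
       Cmp A X Y Z i j (Scl A c g) f = Scl A c (Cmp A X Y Z i j g f)"
    and Cmp_scale_right:
      "\<lbrakk>X \<in> Ob A; Y \<in> Ob A; Z \<in> Ob A; g \<in> Mor A Y Z i; f \<in> Mor A X Y j\<rbrakk> \<Longrightarrow>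
       Cmp A X Y Z i j g (Scl A c f) = Scl A c (Cmp A X Y Z i j g f)"
    and Cmp_assoc:
      "\<lbrakk>W \<in> Ob A; X \<in> Ob A; Y \<in> Ob A; Z \<in> Ob A;
        h \<in> Mor A Y Z i; g \<in> Mor A X Y j; f \<in> Mor A W X l\<rbrakk> \<Longrightarrow>
       Cmp A W X Z (i + j) l (Cmp A X Y Z i j h g) f =
       Cmp A W Y Z i (j + l) h (Cmp A W X Y j l g f)"
    and Leibniz:
      "\<lbrakk>X \<in> Ob A; Y \<in> Ob A; Z \<in> Ob A; g \<in> Mor A Y Z i; f \<in> Mor A X Y j\<rbrakk> \<Longrightarrow>
       Dif A X Z (i + j) (Cmp A X Y Z i j g f) =
       Cmp A X Y Z (i - 1) j (Dif A Y Z i g) f +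
       Scl A ((- 1) ^ i) (Cmp A X Y Z i (j - 1) g (Dif A X Y j f))"
    and Idn_closed: "X \<in> Ob A \<Longrightarrow> Idn A X \<in> Mor A X X 0"
    and Idn_cycle: "X \<in> Ob A \<Longrightarrow> Dif A X X 0 (Idn A X) = 0"
    and Idn_left:
      "\<lbrakk>X \<in> Ob A; Y \<in> Ob A; f \<in> Mor A X Y i\<rbrakk> \<Longrightarrow> Cmp A X Y Y 0 i (Idn A Y) f = f"
    and Idn_right:
      "\<lbrakk>X \<in> Ob A; Y \<in> Ob A; f \<in> Mor A X Y i\<rbrakk> \<Longrightarrow> Cmp A X X Y i 0 f (Idn A X) = f"


section \<open>The spaces \<open>C n m\<close>\<close>

text \<open>
  A cochain is a function of the objects \<open>Ys = [Y\<^sub>0, \<dots>, Y\<^sub>n]\<close>, the degrees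
  \<open>ds = [\<bar>a\<^sub>0\<bar>, \<dots>, \<bar>a\<^sub>n\<bar>]\<close> and the morphisms \<open>as = [a\<^sub>0, \<dots>, a\<^sub>n]\<close>, where \<open>a\<^sub>i\<close> goes from
  \<open>Y\<^bsub>i+1\<^esub>\<close> to \<open>Y\<^sub>i\<close>, with indices modulo \<open>n + 1\<close>. The degree-\<open>m\<close> part of the tensor product
  is the direct sum, over all degrees \<open>ds\<close> with sum \<open>m\<close>, of the tensor products of the
  homogeneous parts; a functional on it is thus a family, indexed by these \<open>ds\<close>, of multilinear
  forms. By convention cochains are \<open>0\<close> on arguments that do not have this form, so that
  equality of functions is equality of cochains.
\<close>

type_synonym ('k, 'o, 'v) cochain = "'o list \<Rightarrow> nat list \<Rightarrow> 'v list \<Rightarrow> 'k"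

definition cyc :: "'a list \<Rightarrow> nat \<Rightarrow> 'a" where
  "cyc xs i = xs ! (i mod length xs)"

definition composable ::
    "('k, 'o, 'v) dg_data \<Rightarrow> nat \<Rightarrow> nat \<Rightarrow> 'o list \<Rightarrow> nat list \<Rightarrow> 'v list \<Rightarrow> bool" where
  "composable A n m Ys ds as \<longleftrightarrow>
     length Ys = Suc n \<and> length ds = Suc n \<and> length as = Suc n \<and>
     set Ys \<subseteq> Ob A \<and> sum_list ds = m \<and>
     (\<forall>i \<le> n. as ! i \<in> Mor A (cyc Ys (i + 1)) (cyc Ys i) (ds ! i))"

definition cochains ::
    "('k::field, 'o, 'v::ab_group_add) dg_data \<Rightarrow> nat \<Rightarrow> nat \<Rightarrow> ('k, 'o, 'v) cochain set" where
  "cochains A n m = {f.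
     (\<forall>Ys ds as. \<not> composable A n m Ys ds as \<longrightarrow> f Ys ds as = 0) \<and>
     (\<forall>Ys ds as. composable A n m Ys ds as \<longrightarrow>
        (\<forall>i \<le> n. \<forall>x \<in> Mor A (cyc Ys (i + 1)) (cyc Ys i) (ds ! i).
            (\<forall>y \<in> Mor A (cyc Ys (i + 1)) (cyc Ys i) (ds ! i).
               f Ys ds (as[i := x + y]) = f Ys ds (as[i := x]) + f Ys ds (as[i := y])) \<and>
            (\<forall>c. f Ys ds (as[i := Scl A c x]) = c * f Ys ds (as[i := x]))))}"

definition zero_outside ::
    "('k::field, 'o, 'v) dg_data \<Rightarrow> nat \<Rightarrow> nat \<Rightarrow> ('k, 'o, 'v) cochain \<Rightarrow> ('k, 'o, 'v) cochain" where
  "zero_outside A n m f = (\<lambda>Ys ds as. if composable A n m Ys ds as then f Ys ds as else 0)"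

definition cscale :: "'k::field \<Rightarrow> ('k, 'o, 'v) cochain \<Rightarrow> ('k, 'o, 'v) cochain" where
  "cscale c f = (\<lambda>Ys ds as. c * f Ys ds as)"


section \<open>The operators\<close>

text \<open>
  Each operator takes the bidegree of its argument, except that \<open>coface\<close> (the operator \<open>b\<close>)
  maps \<open>C n m\<close> to \<open>C (n + 1) m\<close> and \<open>codeg\<close> (the operator \<open>s\<close>) maps \<open>C (n + 1) m\<close> to \<open>C n m\<close>,
  both with parameter \<open>n\<close>.
\<close>

definition koszul :: "nat list \<Rightarrow> nat" where
  "koszul ds = last ds * sum_list (butlast ds)"

text \<open>\<open>\<delta>\<close> from \<open>C n m\<close> to \<open>C n (m + 1)\<close>. Summands with \<open>ds ! i = 0\<close> vanish, as \<open>Dif\<close> is then \<open>0\<close>.\<close>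

definition delta ::
    "('k::field, 'o, 'v) dg_data \<Rightarrow> nat \<Rightarrow> nat \<Rightarrow> ('k, 'o, 'v) cochain \<Rightarrow> ('k, 'o, 'v) cochain" where
  "delta A n m f = zero_outside A n (Suc m) (\<lambda>Ys ds as.
     (- 1) ^ m * (\<Sum>i\<le>n. (- 1) ^ sum_list (take i ds) *
        f Ys (ds[i := ds ! i - 1])
             (as[i := Dif A (cyc Ys (i + 1)) (cyc Ys i) (ds ! i) (as ! i)])))"

text \<open>
  Composing \<open>a\<^sub>i a\<^bsub>i+1\<^esub>\<close> removes the object \<open>Y\<^bsub>i+1\<^esub>\<close>; composing \<open>a\<^bsub>n+1\<^esub> a\<^sub>0\<close> removes \<open>Y\<^sub>0\<close>
  and moves \<open>Y\<^bsub>n+1\<^esub>\<close> to the front.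
\<close>

definition merge :: "nat \<Rightarrow> 'a \<Rightarrow> 'a list \<Rightarrow> 'a list" where
  "merge i x xs = take i xs @ x # drop (i + 2) xs"

definition coface ::
    "('k::field, 'o, 'v) dg_data \<Rightarrow> nat \<Rightarrow> nat \<Rightarrow> ('k, 'o, 'v) cochain \<Rightarrow> ('k, 'o, 'v) cochain" where
  "coface A n m f = zero_outside A (Suc n) m (\<lambda>Ys ds as.
     (\<Sum>i\<le>n. (- 1) ^ i *
        f (merge i (Ys ! i) Ys)
          (merge i (ds ! i + ds ! (i + 1)) ds)
          (merge i (Cmp A (cyc Ys (i + 2)) (cyc Ys (i + 1)) (cyc Ys i)
                      (ds ! i) (ds ! (i + 1)) (as ! i) (as ! (i + 1))) as)) +
     (- 1) ^ (Suc n + koszul ds) *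
        f (last Ys # tl (butlast Ys))
          ((last ds + hd ds) # tl (butlast ds))
          (Cmp A (Ys ! 1) (Ys ! 0) (last Ys) (last ds) (hd ds) (last as) (hd as)
             # tl (butlast as)))"

definition tau ::
    "('k::field, 'o, 'v) dg_data \<Rightarrow> nat \<Rightarrow> nat \<Rightarrow> ('k, 'o, 'v) cochain \<Rightarrow> ('k, 'o, 'v) cochain" where
  "tau A n m f = zero_outside A n m (\<lambda>Ys ds as.
     (- 1) ^ (n + koszul ds) *
        f (last Ys # butlast Ys) (last ds # butlast ds) (last as # butlast as))"

definition cnorm ::
    "('k::field, 'o, 'v) dg_data \<Rightarrow> nat \<Rightarrow> nat \<Rightarrow> ('k, 'o, 'v) cochain \<Rightarrow> ('k, 'o, 'v) cochain" where
  "cnorm A n m f = (\<Sum>i\<le>n. (tau A n m ^^ i) f)"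

definition codeg ::
    "('k::field, 'o, 'v) dg_data \<Rightarrow> nat \<Rightarrow> nat \<Rightarrow> ('k, 'o, 'v) cochain \<Rightarrow> ('k, 'o, 'v) cochain" where
  "codeg A n m f = zero_outside A n m (\<lambda>Ys ds as.
     (- 1) ^ n * f (Ys @ [Ys ! 0]) (ds @ [0]) (as @ [Idn A (Ys ! 0)]))"

definition Connes_B ::
    "('k::field, 'o, 'v) dg_data \<Rightarrow> nat \<Rightarrow> nat \<Rightarrow> ('k, 'o, 'v) cochain \<Rightarrow> ('k, 'o, 'v) cochain" where
  "Connes_B A n m f =
     (case n of 0 \<Rightarrow> 0 | Suc l \<Rightarrow> cnorm A l m (codeg A l m (f - tau A n m f)))"


section \<open>Hochschild cohomology\<close>

definition Hoch_complex ::
    "('k::field, 'o, 'v::ab_group_add) dg_data \<Rightarrow> int \<Rightarrow> (nat \<Rightarrow> nat \<Rightarrow> ('k, 'o, 'v) cochain) set" where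
  "Hoch_complex A n =
     {x. \<forall>p q. x p q \<in> cochains A p q \<and> (int (p + q) \<noteq> n \<longrightarrow> x p q = 0)}"

definition Hoch_d ::
    "('k::field, 'o, 'v) dg_data \<Rightarrow>
     (nat \<Rightarrow> nat \<Rightarrow> ('k, 'o, 'v) cochain) \<Rightarrow> nat \<Rightarrow> nat \<Rightarrow> ('k, 'o, 'v) cochain" where
  "Hoch_d A x = (\<lambda>p q.
     (if 0 < p then coface A (p - 1) q (x (p - 1) q) else 0) +
     (if 0 < q then cscale ((- 1) ^ p) (delta A p (q - 1) (x p (q - 1))) else 0))"

definition HH ::
    "('k::field, 'o, 'v::ab_group_add) dg_data \<Rightarrow> int \<Rightarrow>
     ('k, (nat \<Rightarrow> nat \<Rightarrow> ('k, 'o, 'v) cochain) set) module" where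
  "HH A n = cohomology (\<lambda>c x p q. cscale c (x p q)) (Hoch_complex A) (Hoch_d A) n"

definition Hoch_B ::
    "('k::field, 'o, 'v) dg_data \<Rightarrow>
     (nat \<Rightarrow> nat \<Rightarrow> ('k, 'o, 'v) cochain) \<Rightarrow> nat \<Rightarrow> nat \<Rightarrow> ('k, 'o, 'v) cochain" where
  "Hoch_B A x = (\<lambda>p q. Connes_B A (p + 1) q (x (p + 1) q))"

text \<open>The map from \<open>HH A n\<close> to \<open>HH A (n - 1)\<close> induced by \<open>B\<close>.\<close>

definition HH_B ::
    "('k::field, 'o, 'v::ab_group_add) dg_data \<Rightarrow> int \<Rightarrow>
     (nat \<Rightarrow> nat \<Rightarrow> ('k, 'o, 'v) cochain) set \<Rightarrow> (nat \<Rightarrow> nat \<Rightarrow> ('k, 'o, 'v) cochain) set" where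
  "HH_B A n = induced_map (Hoch_B A) (Hoch_d A ` Hoch_complex A (n - 2))"


section \<open>Cyclic cohomology\<close>

definition EC ::
    "('k::field, 'o, 'v::ab_group_add) dg_data \<Rightarrow> nat \<Rightarrow> nat \<Rightarrow> nat \<Rightarrow> ('k, 'o, 'v) cochain set" where
  "EC A p q r = (if p \<le> q then cochains A (q - p) r else {0})"

definition TEC ::
    "('k::field, 'o, 'v::ab_group_add) dg_data \<Rightarrow> int \<Rightarrow>
     (nat \<Rightarrow> nat \<Rightarrow> nat \<Rightarrow> ('k, 'o, 'v) cochain) set" where
  "TEC A n = {x. \<forall>p q r. x p q r \<in> EC A p q r \<and> (int (p + q + r) \<noteq> n \<longrightarrow> x p q r = 0)}"

definition TEC_d ::
    "('k::field, 'o, 'v) dg_data \<Rightarrow>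
     (nat \<Rightarrow> nat \<Rightarrow> nat \<Rightarrow> ('k, 'o, 'v) cochain) \<Rightarrow>
     nat \<Rightarrow> nat \<Rightarrow> nat \<Rightarrow> ('k, 'o, 'v) cochain" where
  "TEC_d A x = (\<lambda>p q r.
     (if p < q then coface A (q - 1 - p) r (x p (q - 1) r) else 0) +
     (if 0 < p \<and> p \<le> q then Connes_B A (q - (p - 1)) r (x (p - 1) q r) else 0) +
     (if p \<le> q \<and> 0 < r
      then cscale ((- 1) ^ (q - p)) (delta A (q - p) (r - 1) (x p q (r - 1))) else 0))"

definition tscale ::
    "'k::field \<Rightarrow> (nat \<Rightarrow> nat \<Rightarrow> nat \<Rightarrow> ('k, 'o, 'v) cochain) \<Rightarrow>
     nat \<Rightarrow> nat \<Rightarrow> nat \<Rightarrow> ('k, 'o, 'v) cochain" where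
  "tscale c x = (\<lambda>p q r. cscale c (x p q r))"

definition HC ::
    "('k::field, 'o, 'v::ab_group_add) dg_data \<Rightarrow> int \<Rightarrow>
     ('k, (nat \<Rightarrow> nat \<Rightarrow> nat \<Rightarrow> ('k, 'o, 'v) cochain) set) module" where
  "HC A n = cohomology tscale (TEC A) (TEC_d A) n"

definition F1 ::
    "('k::field, 'o, 'v::ab_group_add) dg_data \<Rightarrow> int \<Rightarrow> int \<Rightarrow>
     (nat \<Rightarrow> nat \<Rightarrow> nat \<Rightarrow> ('k, 'o, 'v) cochain) set" where
  "F1 A s n = {x \<in> TEC A n. \<forall>p q r. int p < s \<longrightarrow> x p q r = 0}"

end

theory Submission
  imports Defs
begin

text \<open>
  The surjection sends the class of a cocycle \<open>x\<close> of the cyclic complex to the class of its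
  column \<open>x 0\<close>, the part with \<open>p = 0\<close>. In the columns \<open>0\<close> and \<open>1\<close> the equation
  \<open>TEC_d A x = 0\<close> says that \<open>x 0\<close> is a Hochschild cocycle and that \<open>B (x 0)\<close> is the Hochschild
  boundary of minus the column \<open>1\<close>. So the class of \<open>x 0\<close> lies in the kernel of the map
  induced by \<open>B\<close>.

  Conversely, let \<open>z\<close> be a Hochschild cocycle with \<open>B z = d y\<close>. The element with columns
  \<open>z, - y, 0, 0, \<dots>\<close> has a differential of filtration at least \<open>2\<close>, so it represents a class on
  the page \<open>E\<^sub>2\<close>. Since the differentials from this page on vanish, elements of filtration at least
  \<open>1\<close> can be subtracted so that the differential moves into ever deeper filtration, until it
  is \<open>0\<close> because the filtration is bounded (\<open>degenerates_imp_lift\<close>). The column \<open>0\<close> is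
  \<open>z\<close> throughout.

  The kernel consists of the classes of such \<open>z\<close> only because \<open>B\<close> respects Hochschild
  boundaries, that is, anticommutes with the Hochschild differential (\<open>Hoch_B_Hoch_d\<close>). This
  is where the work lies. Write \<open>E\<^sub>i\<close> for the faces with their signs, \<open>b'\<close> for
  \<open>E\<^sub>0 + \<dots> + E\<^sub>n\<close> and \<open>b = b' + \<tau> E\<^sub>0\<close>. From \<open>\<tau> E\<^bsub>i+1\<^esub> = E\<^sub>i \<tau>\<close> and the finite order of
  \<open>\<tau>\<close>, every \<open>E\<^sub>i\<close> is \<open>\<tau>\<^bsup>-i\<^esup> E\<^sub>0 \<tau>\<^bsup>i\<^esup>\<close>, and \<open>b\<close> is the sum of these conjugates over one
  full turn. This gives \<open>(1 - \<tau>) b = b' (1 - \<tau>)\<close> and \<open>b N = N b'\<close>. Together with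
  \<open>s b' + b' s = 1\<close> it follows that
  \<open>B b + b B = N (s b' + b' s) (1 - \<tau>) = N (1 - \<tau>) = 0\<close>. The internal differential commutes with
  \<open>\<tau>\<close> and \<open>s\<close>, hence with \<open>B\<close>.
\<close>

section \<open>Linear maps between subquotients\<close>

lemma coset_eq_iff_mem:
  assumes "vector_space scl" "Modules.module.subspace scl W"
  shows "z +o W = W \<longleftrightarrow> z \<in> W"
proof -
  interpret vector_space scl by fact
  show ?thesis
  proof
    assume "z +o W = W"
    then show "z \<in> W"
      using subspace_0[OF assms(2)] by (metis add.right_neutral set_plus_intro2)
  next
    assume z: "z \<in> W"
    have "w \<in> z +o W" if "w \<in> W" for w
      using set_plus_intro2[OF subspace_diff[OF assms(2) that z], of z] by simp
    then show "z +o W = W"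
      using subspace_add[OF assms(2) z] by (auto simp: elt_set_plus_def)
  qed
qed

lemma coset_absorb:
  assumes "vector_space scl" "Modules.module.subspace scl W" "V \<subseteq> W" "0 \<in> V"
  shows "(z +o V) + W = z +o W"
proof -
  interpret vector_space scl by fact
  show ?thesis
  proof
    show "(z +o V) + W \<subseteq> z +o W"
      using assms(3) subspace_add[OF assms(2)]
      by (auto simp: elt_set_plus_def set_plus_def add.assoc)
    have "z + w \<in> (z +o V) + W" if "w \<in> W" for w
      using set_plus_intro[OF set_plus_intro2[OF assms(4), of z] that] by simp
    then show "z +o W \<subseteq> (z +o V) + W"
      by (auto simp: elt_set_plus_def)
  qed
qed

lemma coset_add_coset:
  assumes "vector_space scl" "Modules.module.subspace scl W"
  shows "(y +o W) + (z +o W) = (y + z) +o W"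
proof -
  interpret vector_space scl by fact
  have "(y +o W) + (z +o W) = (y + z) +o (W + W)"
    by (simp add: set_plus_rearrange)
  also have "W + W = W"
    using coset_absorb[OF assms order_refl subspace_0[OF assms(2)], of 0] by simp
  finally show ?thesis .
qed

lemma induced_map_coset:
  assumes "Vector_Spaces.linear scl scl' f" "Modules.module.subspace scl W"
    "Modules.module.subspace scl' W'" "f ` W \<subseteq> W'"
  shows "induced_map f W' (z +o W) = f z +o W'"
proof -
  interpret Vector_Spaces.linear scl scl' f by fact
  have "f ` (z +o W) = f z +o f ` W"
    by (auto simp: elt_set_plus_def simp flip: add)
  moreover have "0 \<in> f ` W"
    using vs1.subspace_0[OF assms(2)] zero by (metis imageI)
  ultimately show ?thesis
    unfolding induced_map_def
    using coset_absorb[OF vs2.vector_space_axioms assms(3,4)] by simp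
qed

text \<open>
  The codomain is a set \<open>K\<close> of cosets and not the whole quotient, so that the map can be
  corestricted to a kernel.
\<close>
lemma induced_map_in_linear_maps:
  assumes f: "Vector_Spaces.linear scl scl' f"
    and W: "Modules.module.subspace scl W" and W': "Modules.module.subspace scl' W'"
    and fW: "f ` W \<subseteq> W'"
    and Z: "\<And>z. z \<in> Z \<Longrightarrow> f z +o W' \<in> K"
  shows "induced_map f W' \<in>
    linear_maps (quotient_space scl Z W) ((quotient_space scl' Z' W')\<lparr>carrier := K\<rparr>)"
proof -
  interpret Vector_Spaces.linear scl scl' f by fact
  note coset = induced_map_coset[OF f W W' fW]
  have scale1: "scl c ` (z +o W) + W = scl c z +o W" for c z
    using induced_map_coset[OF vs1.linear_scale_self W W, of c z] vs1.subspace_scale[OF W]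
    by (auto simp: induced_map_def)
  have scale2: "scl' c ` (z +o W') + W' = scl' c z +o W'" for c z
    using induced_map_coset[OF vs2.linear_scale_self W' W', of c z] vs2.subspace_scale[OF W']
    by (auto simp: induced_map_def)
  show ?thesis
    unfolding linear_maps_def quotient_space_def
    by (auto simp: hom_def coset scale1 scale2 scale add Z
        coset_add_coset[OF vs1.vector_space_axioms W] coset_add_coset[OF vs2.vector_space_axioms W'])
qed


section \<open>Degeneration and the lifting of cycles\<close>

text \<open>
  If \<open>x\<close> survives to the page \<open>E\<^sub>r\<close>, the vanishing of \<open>d\<^sub>r\<close> on its class says that
  \<open>d x = w + d u\<close> with \<open>u\<close> of filtration at least \<open>s + 1\<close> and \<open>w\<close> of filtration at least
  \<open>s + r + 1\<close>, so \<open>x - u\<close> survives to \<open>E\<^bsub>r+1\<^esub>\<close>. This is repeated until the filtration is exhausted.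
\<close>
lemma degenerates_imp_lift:
  fixes d :: "'x::ab_group_add \<Rightarrow> 'x"
  assumes deg: "degenerates_at r0 scl F d"
    and d_diff: "\<And>x y. d (x - y) = d x - d y"
    and F_0: "\<And>s n. 0 \<in> F s n"
    and F_diff: "\<And>s n x y. x \<in> F s n \<Longrightarrow> y \<in> F s n \<Longrightarrow> x - y \<in> F s n"
    and F_dec: "\<And>s n. F (s + 1) n \<subseteq> F s n"
    and F_bounded: "F (s + r0 + int N) (s + t + 1) = {0}"
    and x: "x \<in> ss_Z F d r0 s t"
  shows "\<exists>v \<in> F (s + 1) (s + t). d (x - v) = 0"
proof -
  have d_0: "d 0 = 0"
    using d_diff[of 0 0] by simp
  have Z_0: "0 \<in> ss_Z F d r s t" for r s t
    by (simp add: ss_Z_def F_0 d_0)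
  then have B_0: "0 \<in> ss_B F d r s t" for r s t
    unfolding ss_B_def using set_plus_intro[of 0 _ "d 0"] d_0 by (metis add.left_neutral imageI)
  have "\<exists>v \<in> F (s + 1) (s + t). x - v \<in> ss_Z F d (r0 + int k) s t" for k
  proof (induction k)
    case 0
    then show ?case
      using x F_0 by (intro bexI[of _ 0]) auto
  next
    case (Suc k)
    define r where "r = r0 + int k"
    obtain v where v: "v \<in> F (s + 1) (s + t)" "x - v \<in> ss_Z F d r s t"
      using Suc unfolding r_def by blast
    let ?U = "(x - v) +o ss_B F d r s t" and ?B = "ss_B F d r (s + r) (t - r + 1)"
    have "ss_d F d r s t ?U = ?B"
      using deg v(2) unfolding degenerates_at_def r_def ss_E_def quotient_space_def by auto
    moreover have "x - v \<in> ?U"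
      using B_0 by (metis add.right_neutral set_plus_intro2)
    ultimately have "d (x - v) \<in> ?B"
      unfolding ss_d_def induced_map_def using B_0 by (metis add.right_neutral imageI set_plus_intro)
    then obtain w u where w: "w \<in> F (s + r + 1) (s + t + 1)"
      and u: "u \<in> F (s + 1) (s + t)" and eq: "d (x - v) = w + d u"
      unfolding ss_B_def ss_Z_def set_plus_def by (auto simp: algebra_simps)
    have "v + u \<in> F (s + 1) (s + t)"
      using F_diff[OF v(1) F_diff[OF F_0 u]] by simp
    moreover have "d (x - (v + u)) = w"
      using eq d_diff[of "x - v" u] by (simp add: diff_diff_eq)
    moreover have "x - (v + u) \<in> F s (s + t)"
      using v(2) u F_diff[of "x - v" s "s + t" u] F_dec[of s "s + t"]
      by (auto simp: ss_Z_def diff_diff_eq)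
    ultimately show ?case
      using w by (intro bexI[of _ "v + u"]) (auto simp: ss_Z_def r_def algebra_simps)
  qed
  from this[of N] show ?thesis
    using F_bounded by (auto simp: ss_Z_def add.assoc)
qed


section \<open>The space of cochains\<close>

lemma vector_space_cscale: "vector_space cscale"
  by unfold_locales (auto simp: cscale_def fun_eq_iff algebra_simps)

lemmas module_cscale = vector_space_cscale[folded module_iff_vector_space]

lemma cscale_apply: "cscale c f Ys ds as = c * f Ys ds as"
  by (simp add: cscale_def)

lemma cochains_eq_0:
  "\<lbrakk>f \<in> cochains A n m; \<not> composable A n m Ys ds as\<rbrakk> \<Longrightarrow> f Ys ds as = 0"
  by (simp add: cochains_def)

lemma composable_list_update:
  assumes "a \<in> Mor A (cyc Ys (i + 1)) (cyc Ys i) (ds ! i)" "composable A n m Ys ds as"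
  shows "composable A n m Ys ds (as[i := a])"
  using assms unfolding composable_def
  by (metis length_list_update nth_list_update_eq nth_list_update_neq list_update_beyond not_le)

text \<open>
  Exchanging one entry within its space of morphisms does not affect whether arguments are
  composable. This lets cochains be treated as linear in every slot, whatever the other
  arguments are.
\<close>
lemma composable_list_update_iff:
  assumes "a \<in> Mor A (cyc Ys (i + 1)) (cyc Ys i) (ds ! i)"
    and "b \<in> Mor A (cyc Ys (i + 1)) (cyc Ys i) (ds ! i)"
  shows "composable A n m Ys ds (as[i := a]) \<longleftrightarrow> composable A n m Ys ds (as[i := b])"
  using composable_list_update[OF assms(1), of n m "as[i := b]"]
    composable_list_update[OF assms(2), of n m "as[i := a]"] by auto

lemma zero_outside_composable:
  "composable A n m Ys ds as \<Longrightarrow> zero_outside A n m f Ys ds as = f Ys ds as"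
  by (simp add: zero_outside_def)

lemma zero_outside_not_composable:
  "\<not> composable A n m Ys ds as \<Longrightarrow> zero_outside A n m f Ys ds as = 0"
  by (simp add: zero_outside_def)

context dg_category
begin

lemma Mor_add: "\<lbrakk>X \<in> Ob A; Y \<in> Ob A; x \<in> Mor A X Y i; y \<in> Mor A X Y i\<rbrakk> \<Longrightarrow> x + y \<in> Mor A X Y i"
  and Mor_scale: "\<lbrakk>X \<in> Ob A; Y \<in> Ob A; x \<in> Mor A X Y i\<rbrakk> \<Longrightarrow> Scl A c x \<in> Mor A X Y i"
  and Mor_0: "\<lbrakk>X \<in> Ob A; Y \<in> Ob A\<rbrakk> \<Longrightarrow> 0 \<in> Mor A X Y i"
  using Mor_subspace[of X Y i] ambient[folded module_iff_vector_space]
  by (auto simp: Modules.module.subspace_def)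

lemma cyc_Ob:
  assumes "composable A n m Ys ds as"
  shows "cyc Ys i \<in> Ob A"
proof -
  have "cyc Ys i \<in> set Ys"
    using assms unfolding cyc_def composable_def by (intro nth_mem) auto
  then show ?thesis
    using assms by (auto simp: composable_def)
qed

text \<open>
  If the arguments are composable this is multilinearity; otherwise all three values are \<open>0\<close>.
\<close>
lemma cochains_linear:
  assumes f: "f \<in> cochains A n m" and i: "i \<le> n"
    and Ob: "cyc Ys (i + 1) \<in> Ob A" "cyc Ys i \<in> Ob A"
    and x: "x \<in> Mor A (cyc Ys (i + 1)) (cyc Ys i) (ds ! i)"
    and y: "y \<in> Mor A (cyc Ys (i + 1)) (cyc Ys i) (ds ! i)"
  shows "f Ys ds (as[i := Scl A c x + y]) = c * f Ys ds (as[i := x]) + f Ys ds (as[i := y])"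
proof -
  note cx = Mor_scale[OF Ob x, of c]
  note cxy = Mor_add[OF Ob cx y]
  show ?thesis
  proof (cases "composable A n m Ys ds (as[i := x])")
    case True
    then have "f Ys ds (as[i := x, i := Scl A c x + y]) =
        f Ys ds (as[i := x, i := Scl A c x]) + f Ys ds (as[i := x, i := y])"
      and "f Ys ds (as[i := x, i := Scl A c x]) = c * f Ys ds (as[i := x, i := x])"
      using f i x y cx unfolding cochains_def by blast+
    then show ?thesis by simp
  next
    case False
    then show ?thesis
      using composable_list_update_iff[OF x y, of n m as]
        composable_list_update_iff[OF x cxy, of n m as] by (simp add: cochains_eq_0[OF f])
  qed
qed

text \<open>
  The single identity subsumes additivity and homogeneity: \<open>c = - 1\<close> with \<open>x = y = 0\<close> shows that
  the form vanishes on \<open>0\<close>, after which \<open>c = 1\<close> and \<open>y = 0\<close> give the two properties.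
\<close>
lemma cochainsI:
  assumes outside: "\<And>Ys ds as. \<not> composable A n m Ys ds as \<Longrightarrow> f Ys ds as = 0"
    and linear: "\<And>Ys ds as i x y c. \<lbrakk>composable A n m Ys ds as; i \<le> n;
      x \<in> Mor A (cyc Ys (i + 1)) (cyc Ys i) (ds ! i);
      y \<in> Mor A (cyc Ys (i + 1)) (cyc Ys i) (ds ! i)\<rbrakk> \<Longrightarrow>
      f Ys ds (as[i := Scl A c x + y]) = c * f Ys ds (as[i := x]) + f Ys ds (as[i := y])"
  shows "f \<in> cochains A n m"
proof -
  interpret vector_space "Scl A" by (rule ambient)
  have "f Ys ds (as[i := x + y]) = f Ys ds (as[i := x]) + f Ys ds (as[i := y])"
    and "f Ys ds (as[i := Scl A c x]) = c * f Ys ds (as[i := x])"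
    if "composable A n m Ys ds as" "i \<le> n"
      "x \<in> Mor A (cyc Ys (i + 1)) (cyc Ys i) (ds ! i)"
      "y \<in> Mor A (cyc Ys (i + 1)) (cyc Ys i) (ds ! i)" for Ys ds as i x y c
  proof -
    note zero = Mor_0[OF cyc_Ob[OF that(1)] cyc_Ob[OF that(1)]]
    show "f Ys ds (as[i := x + y]) = f Ys ds (as[i := x]) + f Ys ds (as[i := y])"
      using linear[OF that, of 1] by simp
    have "f Ys ds (as[i := 0]) = 0"
      using linear[OF that(1,2) zero zero, of "- 1"] by simp
    then show "f Ys ds (as[i := Scl A c x]) = c * f Ys ds (as[i := x])"
      using linear[OF that(1-3) zero, of c] by simp
  qed
  then show ?thesis
    unfolding cochains_def using outside by auto
qed

lemma subspace_cochains: "Modules.module.subspace cscale (cochains A n m)"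
proof (rule Modules.module.subspaceI[OF module_cscale])
  show "0 \<in> cochains A n m"
    by (simp add: cochains_def)
next
  fix f g assume fg: "f \<in> cochains A n m" "g \<in> cochains A n m"
  show "f + g \<in> cochains A n m"
    by (rule cochainsI; simp add: cochains_eq_0[OF fg(1)] cochains_eq_0[OF fg(2)] cyc_Ob
        cochains_linear[OF fg(1)] cochains_linear[OF fg(2)]; simp add: algebra_simps)
next
  fix c f assume f: "f \<in> cochains A n m"
  show "cscale c f \<in> cochains A n m"
    by (rule cochainsI; simp add: cscale_apply cochains_eq_0[OF f] cyc_Ob cochains_linear[OF f];
        simp add: algebra_simps)
qed

lemmas cochains_0 = Modules.module.subspace_0[OF module_cscale subspace_cochains]
  and cochains_add = Modules.module.subspace_add[OF module_cscale subspace_cochains]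
  and cochains_diff = Modules.module.subspace_diff[OF module_cscale subspace_cochains]
  and cochains_scale = Modules.module.subspace_scale[OF module_cscale subspace_cochains]
  and cochains_sum = Modules.module.subspace_sum[OF module_cscale subspace_cochains]

end


section \<open>The cyclic operator\<close>

abbreviation rotr :: "'a list \<Rightarrow> 'a list" where
  "rotr xs \<equiv> last xs # butlast xs"

lemma cyc_rotr: "xs \<noteq> [] \<Longrightarrow> cyc (rotr xs) (Suc j) = cyc xs j"
  by (cases xs rule: rev_cases)
    (use mod_less_divisor[of "length xs" j] in
      \<open>auto simp: cyc_def mod_Suc nth_append less_Suc_eq simp del: mod_less_divisor\<close>)

lemma cyc_mod: "cyc xs (i mod length xs) = cyc xs i" "cyc xs (Suc (i mod length xs)) = cyc xs (Suc i)"
  by (simp_all add: cyc_def mod_Suc_eq)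

lemma rotr_list_update:
  "i < length xs \<Longrightarrow> rotr (xs[i := x]) = (rotr xs)[Suc i mod length xs := x]"
  by (cases xs rule: rev_cases) (auto simp: list_update_append1 less_Suc_eq mod_Suc)

text \<open>
  Rotation sends the position \<open>i\<close> to \<open>i + 1\<close> modulo the length. This form covers the last
  position together with the others.
\<close>
lemma rotr_nth: "i < length xs \<Longrightarrow> rotr xs ! (Suc i mod length xs) = xs ! i"
  using cyc_rotr[of xs i] by (cases xs rule: rev_cases) (auto simp: cyc_def)

lemma sum_list_rotr: "ds \<noteq> [] \<Longrightarrow> sum_list (rotr ds) = (sum_list ds :: nat)"
  by (cases ds rule: rev_cases) auto

lemma composable_rotr:
  assumes "composable A n m Ys ds as"
  shows "composable A n m (rotr Ys) (rotr ds) (rotr as)"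
proof -
  have len: "length Ys = Suc n" "length ds = Suc n" "length as = Suc n" "Ys \<noteq> []" "ds \<noteq> []"
    using assms by (auto simp: composable_def)
  have "rotr as ! j \<in> Mor A (cyc (rotr Ys) (j + 1)) (cyc (rotr Ys) j) (rotr ds ! j)" if "j \<le> n" for j
  proof -
    define i where "i = (if j = 0 then n else j - 1)"
    have i: "i \<le> n" "j = Suc i mod Suc n"
      using that by (auto simp: i_def)
    have "cyc (rotr Ys) j = cyc Ys i" "cyc (rotr Ys) (j + 1) = cyc Ys (i + 1)"
      using cyc_mod[of "rotr Ys" "Suc i"] cyc_rotr[OF len(4)] i(2) len(1) by simp_all
    moreover have "rotr as ! j = as ! i" "rotr ds ! j = ds ! i"
      using rotr_nth[of i as] rotr_nth[of i ds] i len by simp_all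
    ultimately show ?thesis
      using assms i(1) by (simp add: composable_def)
  qed
  moreover have "set (rotr Ys) \<subseteq> set Ys"
    using len(4) by (auto dest: in_set_butlastD)
  ultimately show ?thesis
    using assms len sum_list_rotr[OF len(5)] unfolding composable_def by auto
qed

text \<open>
  With \<open>d = last ds\<close> and \<open>M = sum_list ds\<close>, one has \<open>d (M - d) \<equiv> d (M + 1)\<close> modulo \<open>2\<close> because
  \<open>d\<^sup>2 \<equiv> d\<close>. In this form the sign is additive in the entries moved to the front, which makes
  the signs of the powers of \<open>\<tau>\<close> easy to follow.
\<close>
lemma minus_one_power_koszul:
  assumes "ds \<noteq> []"
  shows "(- 1 :: 'a::ring_1) ^ koszul ds = (- 1) ^ (last ds * Suc (sum_list ds))"
  using assms by (cases ds rule: rev_cases) (auto simp: koszul_def minus_one_power_iff)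

lemma tau_composable:
  fixes f :: "('k::field, 'o, 'v) cochain"
  assumes "composable A n m Ys ds as"
  shows "tau A n m f Ys ds as = (- 1) ^ (n + last ds * Suc m) * f (rotr Ys) (rotr ds) (rotr as)"
proof -
  have "ds \<noteq> []" "sum_list ds = m"
    using assms by (auto simp: composable_def)
  then show ?thesis
    using assms minus_one_power_koszul[of ds, where 'a='k]
    by (simp add: tau_def zero_outside_composable power_add)
qed

lemma tau_not_composable: "\<not> composable A n m Ys ds as \<Longrightarrow> tau A n m f Ys ds as = 0"
  by (simp add: tau_def zero_outside_not_composable)

text \<open>
  After \<open>j\<close> steps the last \<open>j\<close> entries stand in front, and each of them has contributed its sign.
\<close>
lemma tau_funpow_composable:
  assumes "composable A n m Ys ds as" "j \<le> Suc n"
  shows "(tau A n m ^^ j) f Ys ds as =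
    (- 1) ^ (j * n + sum_list (drop (Suc n - j) ds) * Suc m) *
      f (drop (Suc n - j) Ys @ take (Suc n - j) Ys)
        (drop (Suc n - j) ds @ take (Suc n - j) ds)
        (drop (Suc n - j) as @ take (Suc n - j) as)"
  using assms
proof (induction j arbitrary: Ys ds as)
  case 0
  then show ?case by (simp add: composable_def)
next
  case (Suc j)
  have len: "length Ys = Suc n" "length ds = Suc n" "length as = Suc n"
    using Suc.prems(1) by (auto simp: composable_def)
  have split: "drop (Suc n - j) (rotr xs) @ take (Suc n - j) (rotr xs) =
      drop (n - j) xs @ take (n - j) xs" if "length xs = Suc n" for xs :: "'x list"
    using that Suc.prems(2) by (cases xs rule: rev_cases) (auto simp: Suc_diff_le)
  have "sum_list (drop (n - j) ds) = last ds + sum_list (drop (Suc n - j) (rotr ds))"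
    using len(2) Suc.prems(2) by (cases ds rule: rev_cases) (auto simp: Suc_diff_le)
  then have sign: "(n + last ds * Suc m) + (j * n + sum_list (drop (Suc n - j) (rotr ds)) * Suc m) =
      Suc j * n + sum_list (drop (n - j) ds) * Suc m"
    by (simp only: add_mult_distrib) simp
  have "(tau A n m ^^ Suc j) f Ys ds as =
      (- 1) ^ (n + last ds * Suc m) * (tau A n m ^^ j) f (rotr Ys) (rotr ds) (rotr as)"
    using Suc.prems by (simp add: tau_composable)
  also have "(tau A n m ^^ j) f (rotr Ys) (rotr ds) (rotr as) =
      (- 1) ^ (j * n + sum_list (drop (Suc n - j) (rotr ds)) * Suc m) *
      f (drop (n - j) Ys @ take (n - j) Ys) (drop (n - j) ds @ take (n - j) ds)
        (drop (n - j) as @ take (n - j) as)"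
    using Suc.IH[OF composable_rotr[OF Suc.prems(1)]] Suc.prems(2) len
    by (simp only: split)
  finally show ?case
    by (simp only: mult.assoc[symmetric] power_add[symmetric] sign diff_Suc_Suc)
qed

context dg_category
begin

lemma tau_in_cochains:
  assumes f: "f \<in> cochains A n m"
  shows "tau A n m f \<in> cochains A n m"
proof (rule cochainsI)
  fix Ys ds as i x y c
  assume comp: "composable A n m Ys ds as" and i: "i \<le> n"
    and x: "x \<in> Mor A (cyc Ys (i + 1)) (cyc Ys i) (ds ! i)"
    and y: "y \<in> Mor A (cyc Ys (i + 1)) (cyc Ys i) (ds ! i)"
  have len: "length Ys = Suc n" "length ds = Suc n" "length as = Suc n" "Ys \<noteq> []"
    using comp by (auto simp: composable_def)
  define j where "j = Suc i mod Suc n"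
  have j: "j \<le> n"
    by (simp add: j_def less_Suc_eq_le[symmetric])
  have slot: "cyc (rotr Ys) j = cyc Ys i" "cyc (rotr Ys) (j + 1) = cyc Ys (i + 1)" "rotr ds ! j = ds ! i"
    using cyc_mod[of "rotr Ys" "Suc i"] cyc_rotr[OF len(4)] len rotr_nth[of i ds] i
    by (simp_all add: j_def)
  have tau: "tau A n m f Ys ds (as[i := z]) =
      (- 1) ^ (n + last ds * Suc m) * f (rotr Ys) (rotr ds) ((rotr as)[j := z])"
    if "z \<in> Mor A (cyc Ys (i + 1)) (cyc Ys i) (ds ! i)" for z
    using tau_composable[OF composable_list_update[OF that comp], of f] rotr_list_update[of i as z] len i
    by (simp add: j_def)
  have "f (rotr Ys) (rotr ds) ((rotr as)[j := Scl A c x + y]) =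
      c * f (rotr Ys) (rotr ds) ((rotr as)[j := x]) + f (rotr Ys) (rotr ds) ((rotr as)[j := y])"
    by (rule cochains_linear[OF f j]) (use x y slot cyc_Ob[OF comp] in simp_all)
  then show "tau A n m f Ys ds (as[i := Scl A c x + y]) =
      c * tau A n m f Ys ds (as[i := x]) + tau A n m f Ys ds (as[i := y])"
    using x y by (simp add: tau Mor_add Mor_scale cyc_Ob[OF comp] algebra_simps)
qed (simp add: tau_not_composable)

lemma tau_funpow_in_cochains: "f \<in> cochains A n m \<Longrightarrow> (tau A n m ^^ i) f \<in> cochains A n m"
  by (induction i) (auto simp: tau_in_cochains)

text \<open>
  After a full turn the sign has exponent \<open>(n + 1) n + m (m + 1)\<close>, which is even.
\<close>
lemma tau_funpow_order:
  assumes f: "f \<in> cochains A n m"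
  shows "(tau A n m ^^ Suc n) f = f"
proof (intro ext)
  fix Ys ds as
  show "(tau A n m ^^ Suc n) f Ys ds as = f Ys ds as"
  proof (cases "composable A n m Ys ds as")
    case True
    have "even (Suc n * n + m * Suc m)" by simp
    then have "(- 1 :: 'k) ^ (Suc n * n + m * Suc m) = 1"
      by (simp only: minus_one_power_iff if_True)
    then show ?thesis
      using tau_funpow_composable[OF True, of "Suc n" f] True
      by (simp add: composable_def)
  next
    case False
    then show ?thesis
      using cochains_eq_0[OF f] cochains_eq_0[OF tau_funpow_in_cochains[OF f]] by metis
  qed
qed

end


section \<open>The faces and the coboundary\<close>

lemma merge_nth:
  assumes "Suc i < length xs" "j < length xs - 1"
  shows "merge i x xs ! j = (if j < i then xs ! j else if j = i then x else xs ! Suc j)"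
  using assms by (auto simp: merge_def nth_append min_def nth_Cons' add.commute)

lemma length_merge: "Suc i < length xs \<Longrightarrow> length (merge i x xs) = length xs - 1"
  by (simp add: merge_def)

lemma merge_list_update:
  assumes "Suc i < length xs" "k < length xs"
  shows "merge i c (xs[k := x]) =
    (if k < i then (merge i c xs)[k := x] else if k \<le> Suc i then merge i c xs
     else (merge i c xs)[k - 1 := x])"
  by (rule nth_equalityI)
    (use assms in \<open>auto simp: length_merge merge_nth nth_list_update\<close>)

lemma merge_update_merged: "Suc i < length xs \<Longrightarrow> (merge i c xs)[i := c'] = merge i c' xs"
  by (simp add: merge_def list_update_append)

lemma cyc_merge:
  assumes "Suc i < length xs" "j < length xs"
  shows "cyc (merge i (xs ! i) xs) j = (if j \<le> i then cyc xs j else cyc xs (Suc j))"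
proof (cases "Suc j = length xs")
  case True
  then show ?thesis
    using assms by (auto simp: cyc_def length_merge merge_nth simp flip: True)
next
  case False
  then show ?thesis
    using assms by (auto simp: cyc_def length_merge merge_nth)
qed

lemma sum_list_merge:
  assumes "Suc i < length xs"
  shows "sum_list (merge i (xs ! i + xs ! Suc i) xs) = (sum_list xs :: nat)"
proof -
  have "xs = take i xs @ xs ! i # xs ! Suc i # drop (i + 2) xs"
    using assms by (simp add: Cons_nth_drop_Suc)
  then have "sum_list xs = sum_list (take i xs @ xs ! i # xs ! Suc i # drop (i + 2) xs)"
    by simp
  then show ?thesis
    by (simp add: merge_def)
qed

lemma set_merge: "Suc i < length xs \<Longrightarrow> set (merge i (xs ! i) xs) \<subseteq> set xs"
  by (auto simp: merge_def dest: in_set_takeD in_set_dropD)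

lemma merge_rotr: "Suc i < length xs - 1 \<Longrightarrow> merge (Suc i) x (rotr xs) = rotr (merge i x xs)"
  by (cases xs rule: rev_cases) (auto simp: merge_def butlast_append)

lemma last_merge: "Suc i < length xs - 1 \<Longrightarrow> last (merge i x xs) = last xs"
  by (cases xs rule: rev_cases) (auto simp: merge_def)

definition merged_arrow where
  "merged_arrow A i Ys ds as =
     Cmp A (cyc Ys (i + 2)) (cyc Ys (i + 1)) (cyc Ys i) (ds ! i) (ds ! (i + 1)) (as ! i) (as ! (i + 1))"

text \<open>
  The sign is part of the face, so that \<open>\<tau>\<close> intertwines consecutive faces without a sign.
\<close>
definition face ::
    "('k::field, 'o, 'v) dg_data \<Rightarrow> nat \<Rightarrow> nat \<Rightarrow> nat \<Rightarrow> ('k, 'o, 'v) cochain \<Rightarrow> ('k, 'o, 'v) cochain" where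
  "face A n m i f = zero_outside A (Suc n) m (\<lambda>Ys ds as.
     (- 1) ^ i * f (merge i (Ys ! i) Ys) (merge i (ds ! i + ds ! (i + 1)) ds)
                   (merge i (merged_arrow A i Ys ds as) as))"

text \<open>
  The operator usually written \<open>b'\<close>: the part of \<open>b\<close> that does not compose around the end.
\<close>
definition coface_open ::
    "('k::field, 'o, 'v) dg_data \<Rightarrow> nat \<Rightarrow> nat \<Rightarrow> ('k, 'o, 'v) cochain \<Rightarrow> ('k, 'o, 'v) cochain" where
  "coface_open A n m f = (\<Sum>i\<le>n. face A n m i f)"

lemma sum_cochain_apply: "(\<Sum>i\<in>I. g i) Ys ds as = (\<Sum>i\<in>I. (g i :: ('k::field, 'o, 'v) cochain) Ys ds as)"
  by (induction I rule: infinite_finite_induct) auto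

lemma face_composable:
  "composable A (Suc n) m Ys ds as \<Longrightarrow> face A n m i f Ys ds as =
     (- 1) ^ i * f (merge i (Ys ! i) Ys) (merge i (ds ! i + ds ! (i + 1)) ds)
                   (merge i (merged_arrow A i Ys ds as) as)"
  by (simp add: face_def zero_outside_composable)

lemma face_not_composable: "\<not> composable A (Suc n) m Ys ds as \<Longrightarrow> face A n m i f Ys ds as = 0"
  by (simp add: face_def zero_outside_not_composable)

text \<open>
  Composing \<open>a\<^bsub>n+1\<^esub> a\<^sub>0\<close> is rotating \<open>a\<^bsub>n+1\<^esub>\<close> to the front and then composing the first two
  morphisms; the Koszul sign and the sign \<open>(- 1)\<^bsup>n+1\<^esup>\<close> are those of \<open>\<tau>\<close>.
\<close>
lemma coface_eq:
  fixes A :: "('k::field, 'o, 'v) dg_data"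
  shows "coface A n m f = coface_open A n m f + tau A (Suc n) m (face A n m 0 f)"
proof (intro ext)
  fix Ys ds as
  show "coface A n m f Ys ds as = (coface_open A n m f + tau A (Suc n) m (face A n m 0 f)) Ys ds as"
  proof (cases "composable A (Suc n) m Ys ds as")
    case True
    have len: "length Ys = Suc (Suc n)" "length ds = Suc (Suc n)" "length as = Suc (Suc n)"
      "Ys \<noteq> []" "ds \<noteq> []" "as \<noteq> []" "sum_list ds = m"
      using True by (auto simp: composable_def)
    have merge_0: "merge 0 x (rotr xs) = x # tl (butlast xs)" for x :: 'x and xs
      by (simp add: merge_def drop_Suc)
    have hd: "rotr xs ! Suc 0 = hd xs" if "length xs = Suc (Suc n)" for xs :: "'x list"
      using that by (cases xs) auto
    have "cyc (rotr Ys) (0 + 2) = Ys ! 1" "cyc (rotr Ys) (0 + 1) = Ys ! 0" "cyc (rotr Ys) 0 = last Ys"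
      using cyc_rotr[OF len(4), of 1] cyc_rotr[OF len(4), of 0] len(1) by (simp_all add: cyc_def numeral_2_eq_2)
    then have arrow: "merged_arrow A 0 (rotr Ys) (rotr ds) (rotr as) =
        Cmp A (Ys ! 1) (Ys ! 0) (last Ys) (last ds) (hd ds) (last as) (hd as)"
      unfolding merged_arrow_def using hd[OF len(2)] hd[OF len(3)] by simp
    show ?thesis
      using True minus_one_power_koszul[OF len(5), where 'a='k] len(7) hd[OF len(2)]
      by (simp add: coface_def coface_open_def zero_outside_composable sum_cochain_apply
          face_composable[OF True] face_composable[OF composable_rotr[OF True]] tau_composable[OF True]
          merge_0 arrow power_add)
        (simp add: merged_arrow_def)
  next
    case False
    then show ?thesis
      by (simp add: coface_def coface_open_def sum_cochain_apply zero_outside_not_composable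
          face_not_composable tau_not_composable)
  qed
qed

context dg_category
begin

lemma composable_merge:
  assumes comp: "composable A (Suc n) m Ys ds as" and i: "i \<le> n"
  shows "composable A n m (merge i (Ys ! i) Ys) (merge i (ds ! i + ds ! (i + 1)) ds)
    (merge i (merged_arrow A i Ys ds as) as)"
proof -
  have len: "length Ys = Suc (Suc n)" "length ds = Suc (Suc n)" "length as = Suc (Suc n)"
    and arrow: "\<And>j. j \<le> Suc n \<Longrightarrow> as ! j \<in> Mor A (cyc Ys (Suc j)) (cyc Ys j) (ds ! j)"
    using comp by (auto simp: composable_def)
  have "merge i (merged_arrow A i Ys ds as) as ! j \<in> Mor A
      (cyc (merge i (Ys ! i) Ys) (j + 1)) (cyc (merge i (Ys ! i) Ys) j)
      (merge i (ds ! i + ds ! (i + 1)) ds ! j)" if j: "j \<le> n" for j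
    using arrow[of j] arrow[of "Suc j"] i j len Cmp_closed cyc_Ob[OF comp]
    by (auto simp: merge_nth cyc_merge merged_arrow_def)
  then show ?thesis
    using comp i len set_merge[of i Ys] unfolding composable_def
    by (auto simp: length_merge sum_list_merge)
qed

lemma face_in_cochains:
  assumes f: "f \<in> cochains A n m" and i: "i \<le> n"
  shows "face A n m i f \<in> cochains A (Suc n) m"
proof (rule cochainsI)
  fix Ys ds as k x y c
  assume comp: "composable A (Suc n) m Ys ds as" and k: "k \<le> Suc n"
    and x: "x \<in> Mor A (cyc Ys (k + 1)) (cyc Ys k) (ds ! k)"
    and y: "y \<in> Mor A (cyc Ys (k + 1)) (cyc Ys k) (ds ! k)"
  note Ob = cyc_Ob[OF comp]
  have len: "length Ys = Suc (Suc n)" "length ds = Suc (Suc n)" "length as = Suc (Suc n)"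
    and arrow: "\<And>j. j \<le> Suc n \<Longrightarrow> as ! j \<in> Mor A (cyc Ys (Suc j)) (cyc Ys j) (ds ! j)"
    using comp by (auto simp: composable_def)
  let ?M = "Mor A (cyc Ys (k + 1)) (cyc Ys k) (ds ! k)"
  let ?Ys = "merge i (Ys ! i) Ys" and ?ds = "merge i (ds ! i + ds ! (i + 1)) ds"
  \<comment> \<open>Whatever the position of \<open>k\<close> relative to the composed pair, the morphism in slot \<open>k\<close> enters
    a single slot \<open>l\<close> of the merged list, and it does so through a linear map \<open>g\<close>: the identity,
    or composition with its neighbour.\<close>
  have "\<exists>as' l g. l \<le> n \<and>
      (\<forall>z \<in> ?M. g z \<in> Mor A (cyc ?Ys (l + 1)) (cyc ?Ys l) (?ds ! l)) \<and>
      (\<forall>z \<in> ?M. merge i (merged_arrow A i Ys ds (as[k := z])) (as[k := z]) = as'[l := g z]) \<and>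
      g (Scl A c x + y) = Scl A c (g x) + g y"
  proof -
    consider "k < i" | "k = i" | "k = Suc i" | "Suc i < k" by linarith
    then show ?thesis
    proof cases
      case 1
      then show ?thesis
        using i k len
        by (intro exI[of _ "merge i (merged_arrow A i Ys ds as) as"] exI[of _ k] exI[of _ "\<lambda>z. z"])
          (auto simp: merge_nth cyc_merge merge_list_update merged_arrow_def)
    next
      case 2
      let ?g = "\<lambda>z. Cmp A (cyc Ys (i + 2)) (cyc Ys (i + 1)) (cyc Ys i) (ds ! i) (ds ! (i + 1)) z (as ! (i + 1))"
      show ?thesis
        using i k len arrow[of "Suc i"] 2 x y Mor_scale[OF Ob Ob x, of c]
        by (intro exI[of _ "merge i 0 as"] exI[of _ i] exI[of _ ?g])
          (auto simp: merge_nth cyc_merge merge_list_update merge_update_merged merged_arrow_def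
            Cmp_closed Cmp_add_left Cmp_scale_left Ob)
    next
      case 3
      let ?g = "\<lambda>z. Cmp A (cyc Ys (i + 2)) (cyc Ys (i + 1)) (cyc Ys i) (ds ! i) (ds ! (i + 1)) (as ! i) z"
      show ?thesis
        using i k len arrow[of i] 3 x y Mor_scale[OF Ob Ob x, of c]
        by (intro exI[of _ "merge i 0 as"] exI[of _ i] exI[of _ ?g])
          (auto simp: merge_nth cyc_merge merge_list_update merge_update_merged merged_arrow_def
            Cmp_closed Cmp_add_right Cmp_scale_right Ob)
    next
      case 4
      then show ?thesis
        using i k len
        by (intro exI[of _ "merge i (merged_arrow A i Ys ds as) as"] exI[of _ "k - 1"] exI[of _ "\<lambda>z. z"])
          (auto simp: merge_nth cyc_merge merge_list_update merged_arrow_def)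
    qed
  qed
  then obtain as' l g where l: "l \<le> n"
    and g: "\<And>z. z \<in> ?M \<Longrightarrow> g z \<in> Mor A (cyc ?Ys (l + 1)) (cyc ?Ys l) (?ds ! l)"
    and merge: "\<And>z. z \<in> ?M \<Longrightarrow>
      merge i (merged_arrow A i Ys ds (as[k := z])) (as[k := z]) = as'[l := g z]"
    and g_linear: "g (Scl A c x + y) = Scl A c (g x) + g y"
    by blast
  have face: "face A n m i f Ys ds (as[k := z]) = (- 1) ^ i * f ?Ys ?ds (as'[l := g z])"
    if "z \<in> ?M" for z
    using face_composable[OF composable_list_update[OF that comp], of i f] merge[OF that] by simp
  have "f ?Ys ?ds (as'[l := g (Scl A c x + y)]) = c * f ?Ys ?ds (as'[l := g x]) + f ?Ys ?ds (as'[l := g y])"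
    unfolding g_linear
    by (rule cochains_linear[OF f l _ _ g[OF x] g[OF y]])
      (use i l len in \<open>simp_all add: cyc_merge Ob\<close>)
  then show "face A n m i f Ys ds (as[k := Scl A c x + y]) =
      c * face A n m i f Ys ds (as[k := x]) + face A n m i f Ys ds (as[k := y])"
    using x y by (simp add: face Mor_add Mor_scale Ob algebra_simps)
qed (simp add: face_not_composable)

lemma coface_open_in_cochains:
  "f \<in> cochains A n m \<Longrightarrow> coface_open A n m f \<in> cochains A (Suc n) m"
  unfolding coface_open_def by (intro cochains_sum) (simp add: face_in_cochains)

lemma coface_in_cochains: "f \<in> cochains A n m \<Longrightarrow> coface A n m f \<in> cochains A (Suc n) m"
  unfolding coface_eq
  by (intro cochains_add coface_open_in_cochains tau_in_cochains face_in_cochains) auto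

text \<open>
  Rotating moves the composed pair one position to the right. The Koszul signs agree since
  composing changes neither the total degree nor the last entry, and the change of \<open>n\<close> in
  the sign of \<open>\<tau>\<close> is absorbed by the signs of the faces.
\<close>
lemma tau_face:
  assumes i: "Suc i \<le> n"
  shows "tau A (Suc n) m (face A n m (Suc i) f) = face A n m i (tau A n m f)"
proof (intro ext)
  fix Ys ds as
  show "tau A (Suc n) m (face A n m (Suc i) f) Ys ds as = face A n m i (tau A n m f) Ys ds as"
  proof (cases "composable A (Suc n) m Ys ds as")
    case True
    have len: "length Ys = Suc (Suc n)" "length ds = Suc (Suc n)" "length as = Suc (Suc n)" "Ys \<noteq> []"
      using True by (auto simp: composable_def)
    have nth: "rotr xs ! Suc j = xs ! j" if "length xs = Suc (Suc n)" "j \<le> n" for xs :: "'x list" and j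
      using that by (cases xs rule: rev_cases) (auto simp: nth_append)
    have arrow: "merged_arrow A (Suc i) (rotr Ys) (rotr ds) (rotr as) = merged_arrow A i Ys ds as"
      using cyc_rotr[OF len(4), of i] cyc_rotr[OF len(4), of "Suc i"] cyc_rotr[OF len(4), of "Suc (Suc i)"]
        nth[OF len(2), of i] nth[OF len(2), of "Suc i"] nth[OF len(3), of i] nth[OF len(3), of "Suc i"] i
      unfolding merged_arrow_def by (simp add: numeral_2_eq_2)
    have "tau A (Suc n) m (face A n m (Suc i) f) Ys ds as =
        (- 1) ^ (Suc n + last ds * Suc m) * ((- 1) ^ Suc i *
          f (merge (Suc i) (Ys ! i) (rotr Ys)) (merge (Suc i) (ds ! i + ds ! Suc i) (rotr ds))
            (merge (Suc i) (merged_arrow A i Ys ds as) (rotr as)))"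
      using nth[OF len(1), of i] nth[OF len(2), of i] nth[OF len(2), of "Suc i"] i
      unfolding tau_composable[OF True] face_composable[OF composable_rotr[OF True]] arrow by simp
    moreover have "face A n m i (tau A n m f) Ys ds as =
        (- 1) ^ i * ((- 1) ^ (n + last ds * Suc m) *
          f (rotr (merge i (Ys ! i) Ys)) (rotr (merge i (ds ! i + ds ! Suc i) ds))
            (rotr (merge i (merged_arrow A i Ys ds as) as)))"
      using i len
      unfolding face_composable[OF True] tau_composable[OF composable_merge[OF True Suc_leD[OF i]]]
      by (simp add: last_merge)
    ultimately show ?thesis
      using i len by (simp add: merge_rotr)
  qed (simp add: tau_not_composable face_not_composable)
qed

end


section \<open>Linearity of the operators\<close>

lemma linear_cscaleI:
  assumes "\<And>f g. T (f + g) = T f + T g" "\<And>c f. T (cscale c f) = cscale c (T f)"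
  shows "Vector_Spaces.linear cscale cscale T"
  using assms vector_space_cscale
  by (simp add: linear_iff_module_hom module_hom_def module_hom_axioms_def module_cscale)

lemmas linear_add = linear_iff_module_hom[THEN iffD1, THEN module_hom.add]
  and linear_diff = linear_iff_module_hom[THEN iffD1, THEN module_hom.diff]
  and linear_neg = linear_iff_module_hom[THEN iffD1, THEN module_hom.neg]
  and linear_0 = linear_iff_module_hom[THEN iffD1, THEN module_hom.zero]
  and linear_scale = linear_iff_module_hom[THEN iffD1, THEN module_hom.scale]
  and linear_sum = linear_iff_module_hom[THEN iffD1, THEN module_hom.sum]

lemma cscale_sum: "cscale c (\<Sum>i\<in>I. g i) = (\<Sum>i\<in>I. cscale c (g i))"
  by (rule Modules.module.scale_sum_right[OF module_cscale])

lemma linear_tau: "Vector_Spaces.linear cscale cscale (tau A n m)"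
  by (rule linear_cscaleI)
    (auto simp: tau_def zero_outside_def cscale_def fun_eq_iff algebra_simps)

lemma linear_face: "Vector_Spaces.linear cscale cscale (face A n m i)"
  by (rule linear_cscaleI)
    (auto simp: face_def zero_outside_def cscale_def fun_eq_iff algebra_simps)

lemma linear_codeg: "Vector_Spaces.linear cscale cscale (codeg A n m)"
  by (rule linear_cscaleI)
    (auto simp: codeg_def zero_outside_def cscale_def fun_eq_iff algebra_simps)

lemma linear_delta: "Vector_Spaces.linear cscale cscale (delta A n m)"
  by (rule linear_cscaleI)
    (auto simp: delta_def zero_outside_def cscale_def fun_eq_iff algebra_simps
      sum.distrib sum_distrib_left)

lemma linear_coface: "Vector_Spaces.linear cscale cscale (coface A n m)"
  by (rule linear_cscaleI)
    (auto simp: coface_def zero_outside_def cscale_def fun_eq_iff algebra_simps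
      sum.distrib sum_distrib_left)

lemma linear_tau_funpow: "Vector_Spaces.linear cscale cscale (tau A n m ^^ i)"
  by (rule linear_cscaleI; induction i)
    (simp_all add: linear_add[OF linear_tau] linear_scale[OF linear_tau])

lemma linear_cnorm: "Vector_Spaces.linear cscale cscale (cnorm A n m)"
  by (rule linear_cscaleI)
    (simp_all add: cnorm_def linear_add[OF linear_tau_funpow] linear_scale[OF linear_tau_funpow]
      sum.distrib cscale_sum)

lemma linear_Connes_B: "Vector_Spaces.linear cscale cscale (Connes_B A n m)"
proof (cases n)
  case 0
  then show ?thesis
    by (intro linear_cscaleI) (simp_all add: Connes_B_def cscale_def fun_eq_iff)
next
  case (Suc l)
  have "cnorm A l m (codeg A l m (cscale c f - tau A n m (cscale c f))) =
      cscale c (cnorm A l m (codeg A l m (f - tau A n m f)))" for c f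
    by (simp add: linear_scale[OF linear_tau] linear_scale[OF linear_codeg] linear_scale[OF linear_cnorm]
        flip: Modules.module.scale_right_diff_distrib[OF module_cscale])
  then show ?thesis
    using Suc by (intro linear_cscaleI)
      (simp_all add: Connes_B_def add_diff_add linear_add[OF linear_tau] linear_add[OF linear_codeg]
        linear_add[OF linear_cnorm])
qed


section \<open>The operator B anticommutes with b\<close>

context dg_category
begin

lemma tau_funpow_face:
  assumes "i \<le> n"
  shows "(tau A (Suc n) m ^^ i) (face A n m i f) = face A n m 0 ((tau A n m ^^ i) f)"
  using assms
proof (induction i arbitrary: f)
  case (Suc i)
  then show ?case
    by (simp only: funpow_Suc_right o_apply tau_face Suc_leD)
qed simp

text \<open>
  The exponent \<open>n + 2 - i\<close> plays the role of \<open>- i\<close>, since \<open>\<tau>\<close> has order dividing \<open>n + 2\<close> on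
  the target.
\<close>
lemma face_eq_conj:
  assumes f: "f \<in> cochains A n m" and i: "i \<le> n"
  shows "face A n m i f = (tau A (Suc n) m ^^ (Suc (Suc n) - i)) (face A n m 0 ((tau A n m ^^ i) f))"
proof -
  have "(tau A (Suc n) m ^^ (Suc (Suc n) - i)) ((tau A (Suc n) m ^^ i) (face A n m i f)) =
      (tau A (Suc n) m ^^ (Suc (Suc n) - i + i)) (face A n m i f)"
    by (simp only: funpow_add o_apply)
  also have "\<dots> = face A n m i f"
    using tau_funpow_order[OF face_in_cochains[OF f i]] i by simp
  finally show ?thesis
    by (simp only: tau_funpow_face[OF i])
qed

lemma coface_open_eq_sum_conj:
  assumes "f \<in> cochains A n m"
  shows "coface_open A n m f =
    (\<Sum>i\<le>n. (tau A (Suc n) m ^^ (Suc (Suc n) - i)) (face A n m 0 ((tau A n m ^^ i) f)))"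
  unfolding coface_open_def using face_eq_conj[OF assms] by (intro sum.cong) auto

text \<open>
  The cyclic face \<open>\<tau> E\<^sub>0\<close> is the conjugate with \<open>i = n + 1\<close>, because \<open>\<tau>\<^bsup>n+1\<^esup> = 1\<close> on the source.
  So \<open>b\<close> extends the sum for \<open>b'\<close> to one full turn.
\<close>
lemma coface_eq_sum_conj:
  assumes f: "f \<in> cochains A n m"
  shows "coface A n m f =
    (\<Sum>i\<le>Suc n. (tau A (Suc n) m ^^ (Suc (Suc n) - i)) (face A n m 0 ((tau A n m ^^ i) f)))"
proof -
  have "tau A (Suc n) m (face A n m 0 f) =
      (tau A (Suc n) m ^^ (Suc (Suc n) - Suc n)) (face A n m 0 ((tau A n m ^^ Suc n) f))"
    by (simp only: tau_funpow_order[OF f]) simp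
  then show ?thesis
    unfolding coface_eq coface_open_eq_sum_conj[OF f] sum.atMost_Suc by simp
qed

text \<open>
  Let \<open>T i\<close> be the conjugates whose sum is \<open>b f\<close>. Precomposing with \<open>\<tau>\<close> turns \<open>T i\<close> into
  \<open>\<tau> (T (i + 1))\<close>, so \<open>\<tau> b f\<close> and \<open>b' \<tau> f\<close> differ by the term \<open>\<tau> (T 0) = T (n + 1)\<close>, and so
  do \<open>b f\<close> and \<open>b' f\<close>.
\<close>
lemma one_minus_tau_coface:
  assumes f: "f \<in> cochains A n m"
  shows "coface A n m f - tau A (Suc n) m (coface A n m f) =
    coface_open A n m (f - tau A n m f)"
proof -
  define T where "T i = (tau A (Suc n) m ^^ (Suc (Suc n) - i)) (face A n m 0 ((tau A n m ^^ i) f))" for i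
  have "coface_open A n m (tau A n m f) = (\<Sum>i\<le>n. tau A (Suc n) m (T (Suc i)))"
    unfolding coface_open_eq_sum_conj[OF tau_in_cochains[OF f]] T_def
    by (intro sum.cong) (simp_all add: Suc_diff_le funpow_swap1)
  moreover have "tau A (Suc n) m (T 0) = T (Suc n)"
  proof -
    have "T 0 = face A n m 0 f"
      using tau_funpow_order[OF face_in_cochains[OF f], of 0] by (simp add: T_def)
    moreover have "T (Suc n) = tau A (Suc n) m (face A n m 0 f)"
      unfolding T_def tau_funpow_order[OF f] by simp
    ultimately show ?thesis by simp
  qed
  ultimately have "tau A (Suc n) m (coface A n m f) = T (Suc n) + coface_open A n m (tau A n m f)"
    unfolding coface_eq_sum_conj[OF f] T_def[symmetric] 
      sum.atMost_shift[of _ "Suc n"] lessThan_Suc_atMost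
    by (simp add: linear_add[OF linear_tau] linear_sum[OF linear_tau])
  moreover have "coface A n m f = coface_open A n m f + T (Suc n)"
    unfolding coface_eq_sum_conj[OF f] coface_open_eq_sum_conj[OF f] T_def by simp
  moreover have "coface_open A n m (f - tau A n m f) =
      coface_open A n m f - coface_open A n m (tau A n m f)"
    by (simp add: coface_open_def linear_diff[OF linear_face] sum_subtractf)
  ultimately show ?thesis by simp
qed

lemma cnorm_in_cochains: "f \<in> cochains A n m \<Longrightarrow> cnorm A n m f \<in> cochains A n m"
  unfolding cnorm_def by (intro cochains_sum tau_funpow_in_cochains)

lemma tau_cnorm:
  assumes f: "f \<in> cochains A n m"
  shows "tau A n m (cnorm A n m f) = cnorm A n m f"
proof -
  have "tau A n m (cnorm A n m f) = (\<Sum>i<Suc n. (tau A n m ^^ Suc i) f)"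
    by (simp add: cnorm_def linear_sum[OF linear_tau] lessThan_Suc_atMost)
  also have "\<dots> = (\<Sum>i<n. (tau A n m ^^ Suc i) f) + f"
    using tau_funpow_order[OF f] by simp
  also have "\<dots> = cnorm A n m f"
    unfolding cnorm_def sum.atMost_shift by simp
  finally show ?thesis .
qed

lemma tau_funpow_cnorm: "f \<in> cochains A n m \<Longrightarrow> (tau A n m ^^ i) (cnorm A n m f) = cnorm A n m f"
  by (induction i) (simp_all add: tau_cnorm)

lemma cnorm_tau: "f \<in> cochains A n m \<Longrightarrow> cnorm A n m (tau A n m f) = cnorm A n m f"
  using tau_cnorm[of f n m] unfolding cnorm_def
  by (simp add: linear_sum[OF linear_tau] funpow_swap1)

lemma cnorm_tau_funpow: "f \<in> cochains A n m \<Longrightarrow> cnorm A n m ((tau A n m ^^ i) f) = cnorm A n m f"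
  by (induction i) (simp_all add: cnorm_tau tau_funpow_in_cochains)

text \<open>
  The norm absorbs \<open>\<tau>\<close> on either side. Hence every conjugate of \<open>E\<^sub>0\<close> in \<open>N b'\<close> becomes
  \<open>N E\<^sub>0 \<tau>\<^sup>i\<close>, and the conjugates in \<open>b N\<close> become the terms of \<open>N E\<^sub>0 N\<close> in reverse order. Both
  sides are \<open>N E\<^sub>0 N\<close>.
\<close>
lemma coface_cnorm:
  assumes f: "f \<in> cochains A n m"
  shows "coface A n m (cnorm A n m f) = cnorm A (Suc n) m (coface_open A n m f)"
proof -
  let ?t = "tau A (Suc n) m" and ?E = "face A n m 0" and ?g = "cnorm A n m f"
  have E: "?E h \<in> cochains A (Suc n) m" if "h \<in> cochains A n m" for h
    using that by (simp add: face_in_cochains)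
  note g = cnorm_in_cochains[OF f]
  have "coface A n m ?g = (\<Sum>i<Suc (Suc n). (?t ^^ (Suc (Suc n) - i)) (?E ?g))"
    unfolding coface_eq_sum_conj[OF g] lessThan_Suc_atMost by (simp only: tau_funpow_cnorm[OF f])
  also have "\<dots> = (\<Sum>i<Suc (Suc n). (?t ^^ Suc (Suc (Suc n) - Suc i)) (?E ?g))"
    by (intro sum.cong) (simp_all add: Suc_diff_le)
  also have "\<dots> = (\<Sum>i<Suc (Suc n). (?t ^^ Suc i) (?E ?g))"
    by (rule sum.nat_diff_reindex)
  also have "\<dots> = cnorm A (Suc n) m (?t (?E ?g))"
    by (simp only: cnorm_def lessThan_Suc_atMost funpow_Suc_right o_apply)
  also have "\<dots> = cnorm A (Suc n) m (?E ?g)"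
    by (rule cnorm_tau[OF E[OF g]])
  also have "\<dots> = (\<Sum>i\<le>n. cnorm A (Suc n) m (?E ((tau A n m ^^ i) f)))"
    by (simp only: cnorm_def[of A n] linear_sum[OF linear_face] linear_sum[OF linear_cnorm])
  also have "\<dots> = cnorm A (Suc n) m (coface_open A n m f)"
    by (simp only: coface_open_eq_sum_conj[OF f] linear_sum[OF linear_cnorm]
        cnorm_tau_funpow[OF E[OF tau_funpow_in_cochains[OF f]]])
  finally show ?thesis .
qed

lemma composable_append_Idn:
  assumes comp: "composable A n m Ys ds as"
  shows "composable A (Suc n) m (Ys @ [Ys ! 0]) (ds @ [0]) (as @ [Idn A (Ys ! 0)])"
    and "j \<le> Suc n \<Longrightarrow> cyc (Ys @ [Ys ! 0]) j = cyc Ys j"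
proof -
  have len: "length Ys = Suc n" "length ds = Suc n" "length as = Suc n"
    using comp by (auto simp: composable_def)
  have cyc: "cyc (Ys @ [Ys ! 0]) j = cyc Ys j" if "j \<le> Suc n" for j
    using that len by (auto simp: cyc_def nth_append less_Suc_eq le_less)
  have wrap: "cyc (Ys @ [Ys ! 0]) (Suc (Suc n)) = Ys ! 0" "cyc Ys (Suc n) = Ys ! 0"
    using len by (simp_all add: cyc_def nth_append)
  have "Ys ! 0 \<in> Ob A"
    using cyc_Ob[OF comp, of 0] len by (simp add: cyc_def)
  then show "composable A (Suc n) m (Ys @ [Ys ! 0]) (ds @ [0]) (as @ [Idn A (Ys ! 0)])"
    using comp len wrap cyc[OF Suc_leI, OF le_imp_less_Suc] cyc[OF le_SucI] cyc[of "Suc n"]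
    unfolding composable_def by (auto simp: nth_append Idn_closed le_Suc_eq[of _ n])
  show "j \<le> Suc n \<Longrightarrow> cyc (Ys @ [Ys ! 0]) j = cyc Ys j"
    by (rule cyc)
qed

lemma codeg_composable:
  "composable A n m Ys ds as \<Longrightarrow>
     codeg A n m f Ys ds as = (- 1) ^ n * f (Ys @ [Ys ! 0]) (ds @ [0]) (as @ [Idn A (Ys ! 0)])"
  by (simp add: codeg_def zero_outside_composable)

lemma codeg_not_composable: "\<not> composable A n m Ys ds as \<Longrightarrow> codeg A n m f Ys ds as = 0"
  by (simp add: codeg_def zero_outside_not_composable)

lemma codeg_in_cochains:
  assumes f: "f \<in> cochains A (Suc n) m"
  shows "codeg A n m f \<in> cochains A n m"
proof (rule cochainsI)
  fix Ys ds as i x y c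
  assume comp: "composable A n m Ys ds as" and i: "i \<le> n"
    and x: "x \<in> Mor A (cyc Ys (i + 1)) (cyc Ys i) (ds ! i)"
    and y: "y \<in> Mor A (cyc Ys (i + 1)) (cyc Ys i) (ds ! i)"
  have len: "length ds = Suc n" "length as = Suc n"
    using comp by (auto simp: composable_def)
  let ?Ys = "Ys @ [Ys ! 0]" and ?as = "as @ [Idn A (Ys ! 0)]"
  have slot: "cyc ?Ys (i + 1) = cyc Ys (i + 1)" "cyc ?Ys i = cyc Ys i" "(ds @ [0]) ! i = ds ! i"
    using composable_append_Idn(2)[OF comp] i len by (simp_all add: nth_append)
  have codeg: "codeg A n m f Ys ds (as[i := z]) = (- 1) ^ n * f ?Ys (ds @ [0]) (?as[i := z])"
    if "z \<in> Mor A (cyc Ys (i + 1)) (cyc Ys i) (ds ! i)" for z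
    using codeg_composable[OF composable_list_update[OF that comp], of f] i len
    by (simp add: list_update_append1)
  have "f ?Ys (ds @ [0]) (?as[i := Scl A c x + y]) =
      c * f ?Ys (ds @ [0]) (?as[i := x]) + f ?Ys (ds @ [0]) (?as[i := y])"
    by (rule cochains_linear[OF f]) (use x y i slot cyc_Ob[OF comp] in simp_all)
  then show "codeg A n m f Ys ds (as[i := Scl A c x + y]) =
      c * codeg A n m f Ys ds (as[i := x]) + codeg A n m f Ys ds (as[i := y])"
    using x y by (simp add: codeg Mor_add Mor_scale cyc_Ob[OF comp] algebra_simps)
qed (simp add: codeg_not_composable)

lemma codeg_face:
  assumes i: "i \<le> n"
  shows "codeg A (Suc n) m (face A (Suc n) m i f) = - face A n m i (codeg A n m f)"
proof (intro ext)
  fix Ys ds as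
  show "codeg A (Suc n) m (face A (Suc n) m i f) Ys ds as = (- face A n m i (codeg A n m f)) Ys ds as"
  proof (cases "composable A (Suc n) m Ys ds as")
    case True
    have len: "length Ys = Suc (Suc n)" "length ds = Suc (Suc n)" "length as = Suc (Suc n)"
      using True by (auto simp: composable_def)
    have merge: "merge i x (xs @ [y]) = merge i x xs @ [y]" if "length xs = Suc (Suc n)"
      for x y :: 'x and xs
      using that i by (simp add: merge_def)
    have nth: "(xs @ [y]) ! i = xs ! i" "(xs @ [y]) ! Suc i = xs ! Suc i" if "length xs = Suc (Suc n)"
      for y :: 'x and xs
      using that i by (simp_all add: nth_append)
    have "merged_arrow A i (Ys @ [Ys ! 0]) (ds @ [0]) (as @ [Idn A (Ys ! 0)]) = merged_arrow A i Ys ds as"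
      using composable_append_Idn(2)[OF True] i nth[OF len(2)] nth[OF len(3)]
      by (simp add: merged_arrow_def)
    moreover have "merge i (Ys ! i) Ys ! 0 = Ys ! 0"
      using i len by (simp add: merge_nth)
    ultimately show ?thesis
      using nth[OF len(1)] nth[OF len(2)]
      unfolding codeg_composable[OF True] face_composable[OF composable_append_Idn(1)[OF True]]
        fun_Compl_def face_composable[OF True] codeg_composable[OF composable_merge[OF True i]]
      by (simp add: merge len)
  qed (simp add: codeg_not_composable face_not_composable)
qed

lemma codeg_last_face:
  assumes f: "f \<in> cochains A n m"
  shows "codeg A n m (face A n m n f) = f"
proof (intro ext)
  fix Ys ds as
  show "codeg A n m (face A n m n f) Ys ds as = f Ys ds as"
  proof (cases "composable A n m Ys ds as")
    case True
    have len: "length Ys = Suc n" "length ds = Suc n" "length as = Suc n"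
      using True by (auto simp: composable_def)
    have "as ! n \<in> Mor A (cyc Ys (Suc n)) (cyc Ys n) (ds ! n)"
      using True by (simp add: composable_def)
    then have "Cmp A (Ys ! 0) (Ys ! 0) (cyc Ys n) (ds ! n) 0 (as ! n) (Idn A (Ys ! 0)) = as ! n"
      using Idn_right[OF cyc_Ob[OF True, of 0] cyc_Ob[OF True, of n]] len
      by (simp add: cyc_def)
    moreover have "cyc (Ys @ [Ys ! 0]) (n + 2) = Ys ! 0" "cyc (Ys @ [Ys ! 0]) (n + 1) = Ys ! 0"
      using len by (simp_all add: cyc_def nth_append)
    ultimately have arrow: "merged_arrow A n (Ys @ [Ys ! 0]) (ds @ [0]) (as @ [Idn A (Ys ! 0)]) = as ! n"
      using composable_append_Idn(2)[OF True, of n] len by (simp add: merged_arrow_def nth_append)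
    have merge: "merge n (xs ! n) (xs @ [y]) = xs" if "length xs = Suc n" for y :: 'x and xs
      using that by (cases xs rule: rev_cases) (auto simp: merge_def)
    show ?thesis
      unfolding codeg_composable[OF True] face_composable[OF composable_append_Idn(1)[OF True]] arrow
      using len merge[OF len(1)] merge[OF len(2)] merge[OF len(3)] by (simp add: nth_append)
  next
    case False
    then show ?thesis
      by (simp add: codeg_not_composable cochains_eq_0[OF f])
  qed
qed

text \<open>
  Inserting the identity at the end commutes with all faces but the last, up to the sign in
  \<open>s\<close>, and the last face removes it again. So \<open>s\<close> is a contracting homotopy for \<open>b'\<close>.
\<close>
lemma codeg_coface_open_Suc:
  assumes f: "f \<in> cochains A (Suc n) m"
  shows "codeg A (Suc n) m (coface_open A (Suc n) m f) + coface_open A n m (codeg A n m f) = f"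
  by (simp add: coface_open_def linear_add[OF linear_codeg] linear_sum[OF linear_codeg] codeg_face
      codeg_last_face[OF f] sum_negf)

lemma Connes_B_in_cochains: "f \<in> cochains A (Suc n) m \<Longrightarrow> Connes_B A (Suc n) m f \<in> cochains A n m"
  by (simp add: Connes_B_def cnorm_in_cochains codeg_in_cochains cochains_diff tau_in_cochains)

lemma cnorm_one_minus_tau: "f \<in> cochains A n m \<Longrightarrow> cnorm A n m (f - tau A n m f) = 0"
  by (simp add: linear_diff[OF linear_cnorm] cnorm_tau)

text \<open>
  On \<open>C\<^sup>0\<close> the operator \<open>\<tau>\<close> is the identity, so already \<open>(1 - \<tau>) b = b' (1 - \<tau>)\<close> vanishes.
\<close>
lemma Connes_B_coface_0:
  assumes f: "f \<in> cochains A 0 m"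
  shows "Connes_B A (Suc 0) m (coface A 0 m f) = 0"
  using tau_funpow_order[OF f] f tau_in_cochains[OF f]
  by (simp add: Connes_B_def one_minus_tau_coface coface_open_def linear_0[OF linear_face]
      linear_0[OF linear_codeg] linear_0[OF linear_cnorm])

lemma Connes_B_coface_Suc:
  assumes f: "f \<in> cochains A (Suc n) m"
  shows "Connes_B A (Suc (Suc n)) m (coface A (Suc n) m f) = - coface A n m (Connes_B A (Suc n) m f)"
proof -
  define g where "g = f - tau A (Suc n) m f"
  have g: "g \<in> cochains A (Suc n) m"
    using f by (simp add: g_def cochains_diff tau_in_cochains)
  have "Connes_B A (Suc (Suc n)) m (coface A (Suc n) m f) + coface A n m (Connes_B A (Suc n) m f) =
      cnorm A (Suc n) m (codeg A (Suc n) m (coface_open A (Suc n) m g) + coface_open A n m (codeg A n m g))"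
    by (simp add: Connes_B_def one_minus_tau_coface[OF f] coface_cnorm codeg_in_cochains[OF g]
        linear_add[OF linear_cnorm] flip: g_def)
  also have "\<dots> = 0"
    unfolding codeg_coface_open_Suc[OF g] unfolding g_def by (rule cnorm_one_minus_tau[OF f])
  finally show ?thesis
    by (simp add: eq_neg_iff_add_eq_0)
qed

end


section \<open>The operator B commutes with the internal differential\<close>

definition delta_term where
  "delta_term A f Ys ds as i =
     f Ys (ds[i := ds ! i - 1])
       (as[i := Dif A (cyc Ys (i + 1)) (cyc Ys i) (ds ! i) (as ! i)])"

lemma delta_composable:
  "composable A n (Suc m) Ys ds as \<Longrightarrow> delta A n m f Ys ds as =
     (- 1) ^ m * (\<Sum>i\<le>n. (- 1) ^ sum_list (take i ds) * delta_term A f Ys ds as i)"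
  by (simp add: delta_def delta_term_def zero_outside_composable)

lemma delta_not_composable: "\<not> composable A n (Suc m) Ys ds as \<Longrightarrow> delta A n m f Ys ds as = 0"
  by (simp add: delta_def zero_outside_not_composable)

text \<open>
  For \<open>ds ! i = 0\<close> the truncated subtraction leaves the degrees unchanged; their sum is then too
  large by one for \<open>f\<close>, which vanishes by convention.
\<close>
lemma delta_term_degree_0:
  assumes "f \<in> cochains A n m" "sum_list ds = Suc m" "i < length ds" "ds ! i = 0"
  shows "delta_term A f Ys ds as i = 0"
proof -
  have "ds[i := ds ! i - 1] = ds"
    using assms(4) list_update_id[of ds i] by simp
  then show ?thesis
    using cochains_eq_0[OF assms(1), of Ys ds] assms(2) by (simp add: delta_term_def composable_def)
qed

lemma sum_list_decrement:
  assumes "i < length ds" "0 < ds ! i"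
  shows "Suc (sum_list (ds[i := ds ! i - 1])) = (sum_list ds :: nat)"
  using assms elem_le_sum_list[of i ds] by (simp add: sum_list_update)

context dg_category
begin

lemma composable_Dif:
  assumes comp: "composable A n (Suc m) Ys ds as" and i: "i \<le> n" "0 < ds ! i"
  shows "composable A n m Ys (ds[i := ds ! i - 1])
    (as[i := Dif A (cyc Ys (i + 1)) (cyc Ys i) (ds ! i) (as ! i)])"
  using comp i sum_list_decrement[of i ds] cyc_Ob[OF comp] Dif_closed
  unfolding composable_def by (auto simp: nth_list_update)

lemma delta_in_cochains:
  assumes f: "f \<in> cochains A n m"
  shows "delta A n m f \<in> cochains A n (Suc m)"
proof (rule cochainsI)
  fix Ys ds as k x y c
  assume comp: "composable A n (Suc m) Ys ds as" and k: "k \<le> n"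
    and x: "x \<in> Mor A (cyc Ys (k + 1)) (cyc Ys k) (ds ! k)"
    and y: "y \<in> Mor A (cyc Ys (k + 1)) (cyc Ys k) (ds ! k)"
  note Ob = cyc_Ob[OF comp]
  have len: "length ds = Suc n" "length as = Suc n"
    using comp by (auto simp: composable_def)
  have "delta_term A f Ys ds (as[k := Scl A c x + y]) i =
      c * delta_term A f Ys ds (as[k := x]) i + delta_term A f Ys ds (as[k := y]) i" if i: "i \<le> n" for i
  proof (cases "i = k")
    case True
    let ?D = "Dif A (cyc Ys (k + 1)) (cyc Ys k) (ds ! k)"
    have "?D (Scl A c x + y) = Scl A c (?D x) + ?D y"
      using x y Mor_scale[OF Ob Ob x, of c] by (simp add: Dif_add Dif_scale Ob)
    moreover have "f Ys (ds[k := ds ! k - 1]) (as[k := Scl A c (?D x) + ?D y]) =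
        c * f Ys (ds[k := ds ! k - 1]) (as[k := ?D x]) + f Ys (ds[k := ds ! k - 1]) (as[k := ?D y])"
      by (rule cochains_linear[OF f k Ob Ob])
        (use Dif_closed[OF Ob Ob x] Dif_closed[OF Ob Ob y] k len in simp_all)
    ultimately show ?thesis
      using True k len by (simp add: delta_term_def)
  next
    case False
    let ?as = "as[i := Dif A (cyc Ys (i + 1)) (cyc Ys i) (ds ! i) (as ! i)]"
    have "f Ys (ds[i := ds ! i - 1]) (?as[k := Scl A c x + y]) =
        c * f Ys (ds[i := ds ! i - 1]) (?as[k := x]) + f Ys (ds[i := ds ! i - 1]) (?as[k := y])"
      by (rule cochains_linear[OF f k Ob Ob]) (use x y False in simp_all)
    then show ?thesis
      using False by (simp add: delta_term_def list_update_swap)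
  qed
  then show "delta A n m f Ys ds (as[k := Scl A c x + y]) =
      c * delta A n m f Ys ds (as[k := x]) + delta A n m f Ys ds (as[k := y])"
    using delta_composable[OF composable_list_update[OF x comp]]
      delta_composable[OF composable_list_update[OF y comp]]
      delta_composable[OF composable_list_update[OF Mor_add[OF Ob Ob Mor_scale[OF Ob Ob x] y] comp]]
    by (simp add: algebra_simps sum.distrib sum_distrib_left)
qed (simp add: delta_not_composable)

text \<open>
  The summand \<open>i\<close> on the right corresponds to the summand \<open>i + 1\<close>, modulo \<open>n + 1\<close>, on the left.
\<close>
lemma tau_delta:
  assumes f: "f \<in> cochains A n m"
  shows "tau A n (Suc m) (delta A n m f) = delta A n m (tau A n m f)"
proof (intro ext)
  fix Ys ds as
  show "tau A n (Suc m) (delta A n m f) Ys ds as = delta A n m (tau A n m f) Ys ds as"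
  proof (cases "composable A n (Suc m) Ys ds as")
    case True
    have len: "length Ys = Suc n" "length ds = Suc n" "length as = Suc n" "Ys \<noteq> []" "ds \<noteq> []"
      and sum: "sum_list ds = Suc m"
      using True by (auto simp: composable_def)
    define g where "g i = (- 1) ^ sum_list (take i ds) * delta_term A (tau A n m f) Ys ds as i" for i
    define h where "h i = (- 1) ^ (n + last ds * Suc (Suc m)) * ((- 1) ^ sum_list (take i (rotr ds)) *
      delta_term A f (rotr Ys) (rotr ds) (rotr as) i)" for i
    have shift: "h (Suc i mod Suc n) = g i" if i: "i \<le> n" for i
    proof (cases "ds ! i = 0")
      case True
      then have "delta_term A (tau A n m f) Ys ds as i = 0"
        using delta_term_degree_0[OF tau_in_cochains[OF f] sum, of i] i len(2) by simp
      moreover have "delta_term A f (rotr Ys) (rotr ds) (rotr as) (Suc i mod Suc n) = 0"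
        using delta_term_degree_0[OF f, of "rotr ds" "Suc i mod Suc n"] sum_list_rotr[OF len(5)]
          rotr_nth[of i ds] True i len(2) sum by simp
      ultimately show ?thesis
        by (simp add: g_def h_def)
    next
      case False
      let ?ds = "ds[i := ds ! i - 1]" and ?D = "Dif A (cyc Ys (i + 1)) (cyc Ys i) (ds ! i) (as ! i)"
      have "delta_term A f (rotr Ys) (rotr ds) (rotr as) (Suc i mod Suc n) =
          f (rotr Ys) (rotr ?ds) (rotr (as[i := ?D]))"
        using cyc_mod[of "rotr Ys" "Suc i"] cyc_rotr[OF len(4)] rotr_nth[of i ds] rotr_nth[of i as]
          rotr_list_update[of i ds] rotr_list_update[of i as] i len
        by (simp add: delta_term_def)
      moreover have "delta_term A (tau A n m f) Ys ds as i =
          (- 1) ^ (n + last ?ds * Suc m) * f (rotr Ys) (rotr ?ds) (rotr (as[i := ?D]))"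
        using tau_composable[OF composable_Dif[OF True i], of f] False by (simp add: delta_term_def)
      \<comment> \<open>For \<open>i < n\<close> the rotated \<open>a\<^sub>n\<close> stands before \<open>\<phi>(a\<^sub>i)\<close> on the left only, which
        compensates for the total degree being larger by one there. For \<open>i = n\<close> the entry moved
        to the front is the one whose degree drops.\<close>
      moreover have "(- 1 :: 'k) ^ (n + last ds * Suc (Suc m) + sum_list (take (Suc i mod Suc n) (rotr ds))) =
          (- 1) ^ (sum_list (take i ds) + (n + last ?ds * Suc m))"
      proof (cases "i = n")
        case last: True
        have "ds = take n ds @ [last ds]"
          using len(2,5) by (metis append_butlast_last_id butlast_conv_take diff_Suc_1)
        then have "sum_list (take n ds) + last ds = Suc m"
          using sum by (metis sum_list_append sum_list_simps(1) sum_list.Cons sum_list.Nil add.right_neutral)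
        moreover have "last ds = ds ! n" "last ?ds = ds ! n - 1"
          using len(2,5) last by (simp_all add: last_conv_nth)
        moreover obtain l where "ds ! n = Suc l"
          using False last not0_implies_Suc by blast
        ultimately show ?thesis
          using last by (auto simp: minus_one_power_iff)
      next
        case not_last: False
        then have "sum_list (take (Suc i mod Suc n) (rotr ds)) = last ds + sum_list (take i ds)"
          using i len(2) by (simp add: take_butlast)
        moreover have "last ?ds = last ds"
          using not_last len(2,5) by (simp add: last_list_update)
        ultimately show ?thesis
          by (auto simp: minus_one_power_iff)
      qed
      ultimately show ?thesis
        unfolding g_def h_def by (simp only: mult.assoc[symmetric] power_add[symmetric])
    qed
    have "sum h {..n} = h 0 + (\<Sum>i<n. h (Suc i))"
      by (rule sum.atMost_shift)
    also have "\<dots> = g n + (\<Sum>i<n. g i)"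
      using shift[of n] shift[OF less_imp_le] by simp
    also have "\<dots> = sum g {..n}"
      by (simp add: lessThan_Suc_atMost[symmetric] add.commute)
    finally show ?thesis
      unfolding tau_composable[OF True] delta_composable[OF composable_rotr[OF True]]
        delta_composable[OF True] g_def h_def sum_distrib_left[symmetric]
      by (simp add: mult.left_commute)
  qed (simp add: tau_not_composable delta_not_composable)
qed

text \<open>
  The inserted identity has degree \<open>0\<close>, so it contributes no summand, and standing last it does
  not change the signs of the others.
\<close>
lemma codeg_delta:
  assumes f: "f \<in> cochains A (Suc n) m"
  shows "codeg A n (Suc m) (delta A (Suc n) m f) = delta A n m (codeg A n m f)"
proof (intro ext)
  fix Ys ds as
  show "codeg A n (Suc m) (delta A (Suc n) m f) Ys ds as = delta A n m (codeg A n m f) Ys ds as"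
  proof (cases "composable A n (Suc m) Ys ds as")
    case True
    have len: "length Ys = Suc n" "length ds = Suc n" "length as = Suc n" and sum: "sum_list ds = Suc m"
      using True by (auto simp: composable_def)
    let ?Ys = "Ys @ [Ys ! 0]" and ?ds = "ds @ [0]" and ?as = "as @ [Idn A (Ys ! 0)]"
    have last: "delta_term A f ?Ys ?ds ?as (Suc n) = 0"
      using delta_term_degree_0[OF f, of ?ds "Suc n"] sum len(2) by (simp add: nth_append)
    have "delta_term A (codeg A n m f) Ys ds as i = (- 1) ^ n * delta_term A f ?Ys ?ds ?as i"
      if i: "i \<le> n" for i
    proof (cases "ds ! i = 0")
      case deg: True
      then show ?thesis
        using delta_term_degree_0[OF codeg_in_cochains[OF f] sum, of i]
          delta_term_degree_0[OF f, of ?ds i] i len(2) sum by (simp add: nth_append)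
    next
      case False
      then show ?thesis
        using codeg_composable[OF composable_Dif[OF True i], of f] composable_append_Idn(2)[OF True] i len
        by (simp add: delta_term_def nth_append list_update_append1)
    qed
    then show ?thesis
      unfolding codeg_composable[OF True] delta_composable[OF composable_append_Idn(1)[OF True]]
        delta_composable[OF True]
      using len by (simp add: last sum_distrib_left mult.left_commute)
  qed (simp add: codeg_not_composable delta_not_composable)
qed

lemma tau_funpow_delta:
  "f \<in> cochains A n m \<Longrightarrow> (tau A n (Suc m) ^^ i) (delta A n m f) = delta A n m ((tau A n m ^^ i) f)"
  by (induction i) (simp_all add: tau_delta tau_funpow_in_cochains)

lemma cnorm_delta:
  "f \<in> cochains A n m \<Longrightarrow> cnorm A n (Suc m) (delta A n m f) = delta A n m (cnorm A n m f)"
  by (simp add: cnorm_def tau_funpow_delta linear_sum[OF linear_delta])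

lemma Connes_B_delta:
  assumes f: "f \<in> cochains A (Suc n) m"
  shows "Connes_B A (Suc n) (Suc m) (delta A (Suc n) m f) = delta A n m (Connes_B A (Suc n) m f)"
proof -
  have g: "f - tau A (Suc n) m f \<in> cochains A (Suc n) m"
    using f by (simp add: cochains_diff tau_in_cochains)
  show ?thesis
    by (simp add: Connes_B_def tau_delta[OF f] codeg_delta[OF g] cnorm_delta codeg_in_cochains[OF g]
        flip: linear_diff[OF linear_delta])
qed

end


section \<open>The Hochschild and cyclic complexes\<close>

lemma vector_space_hscale: "vector_space (\<lambda>c x p q. cscale c (x p q :: ('k::field, 'o, 'v) cochain))"
  by unfold_locales (auto simp: cscale_def fun_eq_iff algebra_simps)

lemma vector_space_tscale: "vector_space (tscale :: 'k::field \<Rightarrow> (_ \<Rightarrow> _ \<Rightarrow> _ \<Rightarrow> ('k, 'o, 'v) cochain) \<Rightarrow> _)"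
  by unfold_locales (auto simp: tscale_def cscale_def fun_eq_iff algebra_simps)

lemmas module_hscale = vector_space_hscale[folded module_iff_vector_space]
  and module_tscale = vector_space_tscale[folded module_iff_vector_space]

lemmas cscale_right_distrib = Modules.module.scale_right_distrib[OF module_cscale]
  and cscale_zero = Modules.module.scale_zero_right[OF module_cscale]

lemma cscale_commute: "cscale a (cscale b f) = cscale b (cscale a f)"
  by (simp add: cscale_def mult.left_commute)

lemma linear_Hoch_d:
  "Vector_Spaces.linear (\<lambda>c x p q. cscale c (x p q)) (\<lambda>c x p q. cscale c (x p q)) (Hoch_d A)"
  unfolding linear_iff_module_hom module_hom_def module_hom_axioms_def
  by (auto simp: module_hscale Hoch_d_def linear_add[OF linear_coface] linear_add[OF linear_delta]
      linear_scale[OF linear_coface] linear_scale[OF linear_delta] cscale_right_distrib cscale_zero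
      cscale_commute[of "(- 1) ^ _"] intro!: ext)

lemma linear_Hoch_B:
  "Vector_Spaces.linear (\<lambda>c x p q. cscale c (x p q)) (\<lambda>c x p q. cscale c (x p q)) (Hoch_B A)"
  unfolding linear_iff_module_hom module_hom_def module_hom_axioms_def
  by (auto simp: module_hscale Hoch_B_def linear_add[OF linear_Connes_B]
      linear_scale[OF linear_Connes_B] intro!: ext)

lemma linear_TEC_d: "Vector_Spaces.linear tscale tscale (TEC_d A)"
  unfolding linear_iff_module_hom module_hom_def module_hom_axioms_def
  by (auto simp: module_tscale TEC_d_def tscale_def linear_add[OF linear_coface]
      linear_add[OF linear_delta] linear_add[OF linear_Connes_B]
      linear_scale[OF linear_coface] linear_scale[OF linear_delta] linear_scale[OF linear_Connes_B]
      cscale_right_distrib cscale_zero cscale_commute[of "(- 1) ^ _"] intro!: ext)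

lemma linear_column_0:
  "Vector_Spaces.linear tscale (\<lambda>c x p q. cscale c (x p q)) (\<lambda>x. x 0)"
  unfolding linear_iff_module_hom module_hom_def module_hom_axioms_def
  by (simp add: module_hscale module_tscale tscale_def)

lemma TEC_d_column_0: "TEC_d A x 0 = Hoch_d A (x 0)"
  by (intro ext) (simp add: TEC_d_def Hoch_d_def)

text \<open>
  In column \<open>1\<close> the index \<open>q\<close> exceeds the Hochschild degree \<open>q - p\<close> by one, hence the shift.
\<close>
lemma TEC_d_column_1:
  "TEC_d A x 1 (Suc q) r = Hoch_d A (\<lambda>p. x 1 (Suc p)) q r + Hoch_B A (x 0) q r"
  by (cases q) (simp_all add: TEC_d_def Hoch_d_def Hoch_B_def algebra_simps)

context dg_category
begin

lemma Hoch_complexD: "x \<in> Hoch_complex A n \<Longrightarrow> x p q \<in> cochains A p q"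
  by (simp add: Hoch_complex_def)

lemma TEC_iff:
  "x \<in> TEC A n \<longleftrightarrow> (\<forall>p q r. (p \<le> q \<longrightarrow> x p q r \<in> cochains A (q - p) r) \<and>
     (q < p \<longrightarrow> x p q r = 0) \<and> (int (p + q + r) \<noteq> n \<longrightarrow> x p q r = 0))"
  unfolding TEC_def EC_def mem_Collect_eq by (intro iff_allI) auto

lemma TECD: "\<lbrakk>x \<in> TEC A n; p \<le> q\<rbrakk> \<Longrightarrow> x p q r \<in> cochains A (q - p) r"
  by (simp add: TEC_iff)

lemma subspace_Hoch_complex:
  "Modules.module.subspace (\<lambda>c x p q. cscale c (x p q)) (Hoch_complex A n)"
  by (rule Modules.module.subspaceI[OF module_hscale])
    (simp_all add: Hoch_complex_def cochains_0 cochains_add cochains_scale cscale_zero)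

lemma subspace_TEC: "Modules.module.subspace tscale (TEC A n)"
  by (rule Modules.module.subspaceI[OF module_tscale])
    (simp_all add: TEC_iff tscale_def cochains_0 cochains_add cochains_scale cscale_zero)

lemma subspace_Hoch_boundaries:
  "Modules.module.subspace (\<lambda>c x p q. cscale c (x p q)) (Hoch_d A ` Hoch_complex A n)"
  by (rule module_hom.subspace_image[OF linear_Hoch_d[unfolded linear_iff_module_hom] subspace_Hoch_complex])

lemma subspace_TEC_boundaries: "Modules.module.subspace tscale (TEC_d A ` TEC A n)"
  by (rule module_hom.subspace_image[OF linear_TEC_d[unfolded linear_iff_module_hom] subspace_TEC])

lemma Hoch_B_in_Hoch_complex:
  assumes "x \<in> Hoch_complex A n"
  shows "Hoch_B A x \<in> Hoch_complex A (n - 1)"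
  using assms
  by (auto simp: Hoch_complex_def Hoch_B_def Connes_B_in_cochains linear_0[OF linear_Connes_B])

lemma Hoch_B_Hoch_d:
  assumes x: "x \<in> Hoch_complex A n"
  shows "Hoch_B A (Hoch_d A x) = - Hoch_d A (Hoch_B A x)"
proof (rule ext, rule ext)
  fix p q
  have "Connes_B A (Suc p) q (coface A p q (x p q)) =
      - (if 0 < p then coface A (p - 1) q (Connes_B A p q (x p q)) else 0)"
    using Connes_B_coface_0[of "x 0 q" q] Connes_B_coface_Suc[of "x p q" "p - 1" q] Hoch_complexD[OF x]
    by (cases p) simp_all
  moreover have "Connes_B A (Suc p) q (delta A (Suc p) (q - 1) (x (Suc p) (q - 1))) =
      delta A p (q - 1) (Connes_B A (Suc p) (q - 1) (x (Suc p) (q - 1)))" if "0 < q"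
    using Connes_B_delta[OF Hoch_complexD[OF x], of p "q - 1"] that by simp
  moreover have "cscale ((- 1) ^ Suc p) f = - cscale ((- 1) ^ p) f" for f :: "('k, 'o, 'v) cochain"
    by (simp add: cscale_def fun_eq_iff)
  ultimately show "Hoch_B A (Hoch_d A x) p q = (- Hoch_d A (Hoch_B A x)) p q"
    by (simp add: Hoch_B_def Hoch_d_def linear_add[OF linear_Connes_B] linear_neg[OF linear_Connes_B]
        linear_scale[OF linear_Connes_B]
        linear_0[OF linear_Connes_B])
qed

lemma TEC_d_in_TEC:
  assumes x: "x \<in> TEC A n"
  shows "TEC_d A x \<in> TEC A (n + 1)"
proof -
  have coch: "x p q r \<in> cochains A l r" if "p \<le> q" "l = q - p" for p q r l
    using TECD[OF x that(1)] that(2) by simp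
  have "TEC_d A x p q r \<in> cochains A (q - p) r" if "p \<le> q" for p q r
  proof -
    have "coface A (q - 1 - p) r (x p (q - 1) r) \<in> cochains A (q - p) r" if "p < q"
      using coface_in_cochains[OF coch[of p "q - 1" "q - 1 - p" r]] that by (simp add: Suc_diff_Suc)
    moreover have "Connes_B A (q - (p - 1)) r (x (p - 1) q r) \<in> cochains A (q - p) r" if "0 < p"
      using Connes_B_in_cochains[OF coch[of "p - 1" q "Suc (q - p)" r]] that \<open>p \<le> q\<close>
      by (simp add: Suc_diff_le)
    moreover have "delta A (q - p) (r - 1) (x p q (r - 1)) \<in> cochains A (q - p) r" if "0 < r"
      using delta_in_cochains[OF coch[of p q "q - p" "r - 1"]] that \<open>p \<le> q\<close> by simp
    ultimately show ?thesis
      by (simp add: TEC_d_def cochains_add cochains_0 cochains_scale)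
  qed
  moreover have "TEC_d A x p q r = 0" if "int (p + q + r) \<noteq> n + 1" for p q r
  proof -
    have zero: "x p' q' r' = 0" if "int (p' + q' + r') \<noteq> n" for p' q' r'
      using x that by (simp add: TEC_def)
    have "(if p < q then coface A (q - 1 - p) r (x p (q - 1) r) else 0) = 0"
      using zero[of p "q - 1" r] that by (simp add: linear_0[OF linear_coface])
    moreover have "(if 0 < p \<and> p \<le> q then Connes_B A (q - (p - 1)) r (x (p - 1) q r) else 0) = 0"
      using zero[of "p - 1" q r] that by (simp add: linear_0[OF linear_Connes_B])
    moreover have "(if p \<le> q \<and> 0 < r
        then cscale ((- 1) ^ (q - p)) (delta A (q - p) (r - 1) (x p q (r - 1))) else 0) = 0"
      using zero[of p q "r - 1"] that by (simp add: linear_0[OF linear_delta] cscale_zero)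
    ultimately show ?thesis
      unfolding TEC_d_def by (simp only: add_0_right)
  qed
  moreover have "TEC_d A x p q r = 0" if "\<not> p \<le> q" for p q r
    using that by (simp add: TEC_d_def)
  ultimately show ?thesis
    by (auto simp: TEC_iff)
qed

lemma column_0_in_Hoch_complex: "x \<in> TEC A n \<Longrightarrow> x 0 \<in> Hoch_complex A n"
  using TECD[of x n 0] by (auto simp: TEC_def Hoch_complex_def)

lemma column_1_in_Hoch_complex: "x \<in> TEC A n \<Longrightarrow> (\<lambda>p. x 1 (Suc p)) \<in> Hoch_complex A (n - 2)"
  using TECD[of x n 1 "Suc _"] by (auto simp: TEC_def Hoch_complex_def)

lemma ex_TEC_columns:
  assumes z: "z \<in> Hoch_complex A n" and y: "y \<in> Hoch_complex A (n - 2)"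
  obtains x where "x \<in> TEC A n" "x 0 = z" "\<And>p. x 1 (Suc p) = y p"
proof
  let ?x = "\<lambda>p q. if p = 0 then z q else if p = 1 \<and> 0 < q then y (q - 1) else 0"
  show "?x \<in> TEC A n"
    using z y by (auto simp: TEC_def EC_def Hoch_complex_def cochains_0)
qed simp_all


text \<open>
  The induced map sends a coset to a coset because \<open>B\<close> maps Hochschild boundaries to Hochschild
  boundaries.
\<close>
lemma a_kernel_HH_B:
  "a_kernel (HH A n) (HH A (n - 1)) (HH_B A n) =
     {z +o Hoch_d A ` Hoch_complex A (n - 1) | z.
        z \<in> Hoch_complex A n \<and> Hoch_d A z = 0 \<and> Hoch_B A z \<in> Hoch_d A ` Hoch_complex A (n - 2)}"
proof -
  let ?W = "Hoch_d A ` Hoch_complex A (n - 1)" and ?W' = "Hoch_d A ` Hoch_complex A (n - 2)"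
  have "Hoch_B A ` ?W \<subseteq> ?W'"
  proof clarify
    fix x assume "x \<in> Hoch_complex A (n - 1)"
    then have "Hoch_B A x \<in> Hoch_complex A (n - 2)"
      using Hoch_B_in_Hoch_complex[of x "n - 1"] by simp
    then have "- Hoch_B A x \<in> Hoch_complex A (n - 2)"
      by (rule Modules.module.subspace_neg[OF module_hscale subspace_Hoch_complex])
    moreover have "Hoch_B A (Hoch_d A x) = Hoch_d A (- Hoch_B A x)"
      using \<open>x \<in> Hoch_complex A (n - 1)\<close> by (simp add: Hoch_B_Hoch_d linear_neg[OF linear_Hoch_d])
    ultimately show "Hoch_B A (Hoch_d A x) \<in> ?W'"
      by (metis imageI)
  qed
  then have "HH_B A n (z +o ?W) = Hoch_B A z +o ?W'" for z
    unfolding HH_B_def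
    by (rule induced_map_coset[OF linear_Hoch_B subspace_Hoch_boundaries subspace_Hoch_boundaries])
  then have "HH_B A n (z +o ?W) = ?W' \<longleftrightarrow> Hoch_B A z \<in> ?W'" for z
    by (simp add: coset_eq_iff_mem[OF vector_space_hscale subspace_Hoch_boundaries])
  then show ?thesis
    unfolding a_kernel_def' HH_def cohomology_def quotient_space_def
    by (simp add: image_def) blast
qed

text \<open>
  The columns \<open>z\<close> and \<open>- y\<close> with \<open>B z = d y\<close> give an element of \<open>Z\<^sub>2\<close>; degeneration corrects it
  to a cocycle by an element of \<open>F\<^sup>1\<close>, which has no column \<open>0\<close>.
\<close>
lemma ex_TEC_cycle_over_Hoch_cycle:
  assumes deg: "degenerates_at 2 tscale (F1 A) (TEC_d A)"
    and z: "z \<in> Hoch_complex A n" "Hoch_d A z = 0"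
    and Bz: "Hoch_B A z \<in> Hoch_d A ` Hoch_complex A (n - 2)"
  shows "\<exists>x \<in> TEC A n. TEC_d A x = 0 \<and> x 0 = z"
proof -
  obtain y where y: "y \<in> Hoch_complex A (n - 2)" "Hoch_B A z = Hoch_d A y"
    using Bz by blast
  have "- y \<in> Hoch_complex A (n - 2)"
    by (rule Modules.module.subspace_neg[OF module_hscale subspace_Hoch_complex y(1)])
  then obtain x where x: "x \<in> TEC A n" "x 0 = z" "\<And>p. x 1 (Suc p) = (- y) p"
    using ex_TEC_columns[OF z(1)] by metis
  have column_1: "(\<lambda>p. x 1 (Suc p)) = - y"
    using x(3) by (simp add: fun_eq_iff)
  have "TEC_d A x 1 q r = 0" for q r
  proof (cases q)
    case 0
    then show ?thesis by (simp add: TEC_d_def)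
  next
    case (Suc l)
    then show ?thesis
      using y(2) x(2) by (simp only: TEC_d_column_1 column_1 linear_neg[OF linear_Hoch_d]) simp
  qed
  moreover have "TEC_d A x 0 q r = 0" for q r
    using z(2) x(2) by (simp add: TEC_d_column_0)
  ultimately have "TEC_d A x \<in> F1 A 2 (n + 1)"
    using TEC_d_in_TEC[OF x(1)] by (auto simp: F1_def less_2_cases_iff nat_less_iff)
  then have Z: "x \<in> ss_Z (F1 A) (TEC_d A) 2 0 n"
    using x(1) by (simp add: ss_Z_def F1_def)
  have F1_0: "0 \<in> F1 A s l" for s l
    using Modules.module.subspace_0[OF module_tscale subspace_TEC] by (simp add: F1_def)
  have F1_diff: "u - w \<in> F1 A s l" if "u \<in> F1 A s l" "w \<in> F1 A s l" for s l u w
    using that Modules.module.subspace_diff[OF module_tscale subspace_TEC] by (simp add: F1_def)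
  have F1_dec: "F1 A (s + 1) l \<subseteq> F1 A s l" for s l
    by (auto simp: F1_def)
  \<comment> \<open>A column \<open>p \<ge> n + 2\<close> is empty in total degree \<open>n + 1\<close>.\<close>
  have F1_bounded: "F1 A (0 + 2 + int (nat n)) (0 + n + 1) = {0}"
  proof -
    have "u = 0" if u: "u \<in> F1 A (0 + 2 + int (nat n)) (0 + n + 1)" for u
    proof (rule ext, rule ext, rule ext)
      fix p q r
      have "int p < 0 + 2 + int (nat n) \<or> int (p + q + r) \<noteq> 0 + n + 1" by linarith
      then have "u p q r = 0"
        using u unfolding F1_def TEC_def by blast
      then show "u p q r = 0 p q r" by simp
    qed
    then show ?thesis
      using F1_0 by blast
  qed
  have "\<exists>v \<in> F1 A (0 + 1) (0 + n). TEC_d A (x - v) = 0"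
    by (rule degenerates_imp_lift[OF deg linear_diff[OF linear_TEC_d] F1_0 F1_diff F1_dec F1_bounded Z])
  then obtain v where v: "v \<in> F1 A 1 n" "TEC_d A (x - v) = 0"
    by auto
  have "(x - v) 0 = z"
    using v(1) x(2) by (auto simp: F1_def fun_eq_iff)
  moreover have "x - v \<in> TEC A n"
    using v(1) x(1) Modules.module.subspace_diff[OF module_tscale subspace_TEC] by (auto simp: F1_def)
  ultimately show ?thesis
    using v(2) by blast
qed

lemma column_0_cycle:
  assumes "x \<in> TEC A n" "TEC_d A x = 0"
  shows "Hoch_d A (x 0) = 0" "Hoch_B A (x 0) \<in> Hoch_d A ` Hoch_complex A (n - 2)"
proof -
  show "Hoch_d A (x 0) = 0"
    using assms(2) by (simp flip: TEC_d_column_0)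
  let ?y = "\<lambda>p. x 1 (Suc p)"
  have "Hoch_B A (x 0) = Hoch_d A (- ?y)"
  proof (rule ext, rule ext)
    fix q r
    have "Hoch_d A ?y q r + Hoch_B A (x 0) q r = 0"
      using assms(2) TEC_d_column_1[of A x q r] by simp
    then show "Hoch_B A (x 0) q r = Hoch_d A (- ?y) q r"
      by (simp add: linear_neg[OF linear_Hoch_d] eq_neg_iff_add_eq_0 add.commute)
  qed
  then show "Hoch_B A (x 0) \<in> Hoch_d A ` Hoch_complex A (n - 2)"
    using Modules.module.subspace_neg[OF module_hscale subspace_Hoch_complex
        column_1_in_Hoch_complex[OF assms(1)]] by blast
qed

end

theorem proposition5p6:
  fixes A :: "('k::field_char_0, 'o, 'v::ab_group_add) dg_data" and n :: int
  assumes "dg_category A"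
    and "degenerates_at 2 tscale (F1 A) (TEC_d A)"
    and "n \<ge> 1"
  shows "\<exists>\<pi>. \<pi> \<in> linear_maps (HC A n)
                 ((HH A n)\<lparr>carrier := a_kernel (HH A n) (HH A (n - 1)) (HH_B A n)\<rparr>) \<and>
             \<pi> ` carrier (HC A n) = a_kernel (HH A n) (HH A (n - 1)) (HH_B A n)"
proof -
  interpret dg_category A by fact
  let ?W = "TEC_d A ` TEC A (n - 1)" and ?W' = "Hoch_d A ` Hoch_complex A (n - 1)"
  let ?K = "a_kernel (HH A n) (HH A (n - 1)) (HH_B A n)"
  let ?\<pi> = "induced_map (\<lambda>x. x 0) ?W'"
  have boundaries: "(\<lambda>x. x 0) ` ?W \<subseteq> ?W'"
    using column_0_in_Hoch_complex by (auto simp: TEC_d_column_0)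
  note coset = induced_map_coset[OF linear_column_0 subspace_TEC_boundaries subspace_Hoch_boundaries boundaries]
  have into: "x 0 +o ?W' \<in> ?K" if "x \<in> {x \<in> TEC A n. TEC_d A x = 0}" for x
    using that column_0_cycle[of x n] column_0_in_Hoch_complex[of x n] unfolding a_kernel_HH_B by blast
  have "?\<pi> \<in> linear_maps (HC A n) ((HH A n)\<lparr>carrier := ?K\<rparr>)"
    using induced_map_in_linear_maps[OF linear_column_0 subspace_TEC_boundaries
        subspace_Hoch_boundaries boundaries, where K = ?K and Z = "{x \<in> TEC A n. TEC_d A x = 0}"
        and Z' = "{z \<in> Hoch_complex A n. Hoch_d A z = 0}"] into
    unfolding HC_def HH_def cohomology_def by blast
  moreover have "?\<pi> ` carrier (HC A n) = ?K"
  proof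
    show "?\<pi> ` carrier (HC A n) \<subseteq> ?K"
      using into by (auto simp: HC_def cohomology_def quotient_space_def coset)
    show "?K \<subseteq> ?\<pi> ` carrier (HC A n)"
    proof
      fix U assume "U \<in> ?K"
      then obtain z where z: "U = z +o ?W'" "z \<in> Hoch_complex A n" "Hoch_d A z = 0"
        "Hoch_B A z \<in> Hoch_d A ` Hoch_complex A (n - 2)"
        unfolding a_kernel_HH_B by blast
      then obtain x where "x \<in> TEC A n" "TEC_d A x = 0" "x 0 = z"
        using ex_TEC_cycle_over_Hoch_cycle[OF assms(2)] by blast
      then show "U \<in> ?\<pi> ` carrier (HC A n)"
        using coset[of x] z(1)
        by (auto simp: HC_def cohomology_def quotient_space_def intro!: image_eqI[of _ _ "x +o ?W"])
    qed
  qed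
  ultimately show ?thesis by blast
qed

end
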